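(* Let $m\ge 1$ be an integer and let $a,b,c$ satisfy $\operatorname{Re}(a)>m-1$, $\operatorname{Re}(b)>m-1$ and $\operatorname{Re}(c)>m-1$. Assume that $\mathbb{F}=(\mathbf{F}_1\,\vdots\,\mathbf{F}_2)'\sim\mathfrak{C}\mathcal{BGB}II_{2m\times m}(a,b,c)$, i.e. that $$\mathbf{F}_1=\mathbf{C}^{-1/2}\mathbf{A}\mathbf{C}^{-1/2},\qquad \mathbf{F}_2=\mathbf{C}^{-1/2}\mathbf{B}\mathbf{C}^{-1/2},$$ where $\mathbf{A}\sim\mathfrak{C}\mathcal{G}_m(a,\mathbf{I}_m)$, $\mathbf{B}\sim\mathfrak{C}\mathcal{G}_m(b,\mathbf{I}_m)$ and $\mathbf{C}\sim\mathfrak{C}\mathcal{G}_m(c,\mathbf{I}_m)$ are independent. Then the density function of $\mathbb{F}$, with respect to the measure $(d\mathbb{F})=(d\mathbf{F}_1)\wedge(d\mathbf{F}_2)$, is $$\frac{|\mathbf{F}_1|^{a-m}\,|\mathbf{F}_2|^{b-m}}{\mathfrak{C}\boldsymbol{\beta}^{*}_m[a,b,c]\;|\mathbf{I}_m+\mathbf{F}_1+\mathbf{F}_2|^{a+b+c}},\qquad \mathbf{F}_1=\mathbf{F}_1^H>\mathbf{0},\quad \mathbf{F}_2=\mathbf{F}_2^H>\mathbf{0}.$$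
   Context: $|\mathbf{A}|$ denotes the determinant, $\mathbf{A}^H$ the conjugate transpose, and $\operatorname{etr}(\mathbf{A})=\exp(\operatorname{tr}\mathbf{A})$. $\mathbf{A}=\mathbf{A}^H>\mathbf{0}$ means Hermitian positive definite; for such $\mathbf{A}$, $\mathbf{A}^{1/2}$ is its unique Hermitian positive definite square root and $\mathbf{A}^{-1/2}=(\mathbf{A}^{1/2})^{-1}$. For a Hermitian $m\times m$ matrix $\mathbf{A}=(a_{rs})$ with $a_{rs}=a_{rs_1}+i\,a_{rs_2}$ (real and imaginary parts), $(d\mathbf{A})=\bigwedge_{r\le s}da_{rs_1}\bigwedge_{r<s}da_{rs_2}$ is Lebesgue measure on the space of Hermitian matrices. The complex multivariate gamma function is $\mathfrak{C}\Gamma_m[a]=\int_{\mathbf{V}=\mathbf{V}^H>\mathbf{0}}\operatorname{etr}(-\mathbf{V})|\mathbf{V}|^{a-m}(d\mathbf{V})=\pi^{m(m-1)/2}\prod_{j=1}^m\Gamma(a-j+1)$ for $\operatorname{Re}(a)>m-1$, and $$\mathfrak{C}\boldsymbol{\beta}^{*}_m[a,b,c]=\frac{\mathfrak{C}\Gamma_m[a]\,\mathfrak{C}\Gamma_m[b]\,\mathfrak{C}\Gamma_m[c]}{\mathfrak{C}\Gamma_m[a+b+c]}.$$ A random Hermitian positive definite matrix $\mathbf{A}\in\mathbb{C}^{m\times m}$ has the complex matrix variate gamma distribution $\mathfrak{C}\mathcal{G}_m(a,\mathbf{I}_m)$, $\operatorname{Re}(a)>m-1$, if its density with respect to $(d\mathbf{A})$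 is $\frac{1}{\mathfrak{C}\Gamma_m[a]}|\mathbf{A}|^{a-m}\operatorname{etr}(-\mathbf{A})$ on $\mathbf{A}=\mathbf{A}^H>\mathbf{0}$. The distribution of the pair $\mathbb{F}=(\mathbf{F}_1\,\vdots\,\mathbf{F}_2)'$ constructed in the claim is called the complex bimatrix variate generalised beta type II distribution and is denoted $\mathfrak{C}\mathcal{BGB}II_{2m\times m}(a,b,c)$. *)

theory Defs
  imports "HOL-Probability.Probability"
begin

section \<open>Hermitian positive definite matrices\<close>

definition ctranspose :: "complex^'n^'m \<Rightarrow> complex^'m^'n" where
  "ctranspose A = (\<chi> i j. cnj (A $ j $ i))"

text \<open>For Hermitian \<open>A\<close> the value \<open>x\<^sup>H A x\<close> is real, so taking \<open>Re\<close> loses nothing.\<close>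

definition hpd :: "complex^'n^'n \<Rightarrow> bool" where
  "hpd A \<longleftrightarrow> ctranspose A = A \<and>
     (\<forall>x. x \<noteq> 0 \<longrightarrow> 0 < Re (\<Sum>i\<in>UNIV. cnj (x $ i) * (A *v x) $ i))"

definition hpd_sqrt :: "complex^'n^'n \<Rightarrow> complex^'n^'n" where
  "hpd_sqrt A = (THE B. hpd B \<and> B ** B = A)"

definition hpd_inv_sqrt :: "complex^'n^'n \<Rightarrow> complex^'n^'n" where
  "hpd_inv_sqrt A = matrix_inv (hpd_sqrt A)"

definition etr :: "complex^'n^'n \<Rightarrow> complex" where
  "etr A = exp (trace A)"


section \<open>Lebesgue measure on the Hermitian matrices\<close>

text \<open>
  The index type is ordered so that the free real coordinates of a Hermitian matrix are
  \<open>Re a\<^sub>r\<^sub>s\<close> for \<open>r \<le> s\<close> (the family \<open>x\<close>) and \<open>Im a\<^sub>r\<^sub>s\<close> for \<open>r < s\<close> (the family \<open>y\<close>).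
\<close>

definition hermitian_of_coords ::
  "('n \<times> 'n \<Rightarrow> real) \<times> ('n \<times> 'n \<Rightarrow> real) \<Rightarrow> complex^'n::{finite,wellorder}^'n::{finite,wellorder}" where
  "hermitian_of_coords = (\<lambda>(x, y). \<chi> r s.
     if r = s then Complex (x (r, r)) 0
     else if r < s then Complex (x (r, s)) (y (r, s))
     else Complex (x (s, r)) (- y (s, r)))"

text \<open>
  As a measure on the Borel sets of all complex matrices, this is concentrated on the Hermitian
  ones.
\<close>

definition hermitian_measure :: "(complex^'n::{finite,wellorder}^'n::{finite,wellorder}) measure" where
  "hermitian_measure =
     distr ((\<Pi>\<^sub>M p\<in>{(r, s). r \<le> s}. lborel) \<Otimes>\<^sub>M (\<Pi>\<^sub>M p\<in>{(r, s). r < s}. lborel))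
       borel hermitian_of_coords"


section \<open>Complex-valued densities\<close>

text \<open>
  The shape parameters are complex, so the density formulas below are complex-valued and
  \<^const>\<open>distributed\<close>, which takes an \<^typ>\<open>ennreal\<close>-valued density, does not apply directly. For
  nonnegative real densities the two notions agree, see \<open>has_density_iff_distributed\<close>.
\<close>

definition has_density :: "'w measure \<Rightarrow> 'a measure \<Rightarrow> ('w \<Rightarrow> 'a) \<Rightarrow> ('a \<Rightarrow> complex) \<Rightarrow> bool" where
  "has_density M N X f \<longleftrightarrow>
     X \<in> measurable M N \<and> integrable N f \<and>
     (\<forall>S\<in>sets N. complex_of_real (measure (distr M N X) S) = (LINT x:S|N. f x))"

lemma has_density_iff_distributed:
  fixes g :: "'a \<Rightarrow> real"
  assumes M: "prob_space M" and g: "g \<in> borel_measurable N" and nonneg: "\<And>x. 0 \<le> g x"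
  shows "has_density M N X (\<lambda>x. complex_of_real (g x)) \<longleftrightarrow> distributed M N X (\<lambda>x. ennreal (g x))"
proof -
  interpret prob_space M by (fact M)
  have set_eq: "(LINT x:S|N. complex_of_real (g x)) = complex_of_real (LINT x:S|N. g x)" for S
    by (rule set_integral_complex_of_real)
  show ?thesis
  proof
    assume H: "has_density M N X (\<lambda>x. complex_of_real (g x))"
    then have X: "X \<in> measurable M N" and "integrable N (\<lambda>x. complex_of_real (g x))"
      by (auto simp: has_density_def)
    then have int: "integrable N g" by (simp add: complex_of_real_integrable_eq)
    interpret D: prob_space "distr M N X" by (rule prob_space_distr[OF X])
    have "distr M N X = density N (\<lambda>x. ennreal (g x))"
    proof (rule measure_eqI)
      fix S assume S: "S \<in> sets (distr M N X)"
      then have S': "S \<in> sets N" by simp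
      have intS: "integrable N (\<lambda>x. indicator S x * g x)"
        using integrable_mult_indicator[OF S' int] by simp
      have "measure (distr M N X) S = (LINT x:S|N. g x)"
        using H S' unfolding has_density_def set_eq of_real_eq_iff by blast
      then have "emeasure (distr M N X) S = ennreal (LINT x|N. indicator S x * g x)"
        by (simp add: D.emeasure_eq_measure set_lebesgue_integral_def)
      also have "\<dots> = (\<integral>\<^sup>+x. ennreal (indicator S x * g x) \<partial>N)"
        by (rule nn_integral_eq_integral[symmetric, OF intS]) (simp add: nonneg)
      also have "\<dots> = (\<integral>\<^sup>+x. ennreal (g x) * indicator S x \<partial>N)"
        by (intro nn_integral_cong) (simp split: split_indicator)
      finally show "emeasure (distr M N X) S = emeasure (density N (\<lambda>x. ennreal (g x))) S"
        using g S' by (simp add: emeasure_density)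
    qed simp
    then show "distributed M N X (\<lambda>x. ennreal (g x))"
      using X g by (simp add: distributed_def)
  next
    assume D: "distributed M N X (\<lambda>x. ennreal (g x))"
    then have X: "X \<in> measurable M N" and eq: "distr M N X = density N (\<lambda>x. ennreal (g x))"
      by (auto simp: distributed_def)
    interpret D: prob_space "distr M N X" by (rule prob_space_distr[OF X])
    have "(\<integral>\<^sup>+x. ennreal (g x) \<partial>N) = emeasure (density N (\<lambda>x. ennreal (g x))) (space N)"
      using g by (simp add: emeasure_density cong: nn_integral_cong)
    also have "\<dots> = 1" using D.emeasure_space_1 eq by simp
    finally have int: "integrable N g"
      using g nonneg by (intro integrableI_nonneg) auto
    have "measure (distr M N X) S = (LINT x:S|N. g x)" if S: "S \<in> sets N" for S
    proof -
      have "measure (distr M N X) S = enn2real (\<integral>\<^sup>+x. ennreal (g x) * indicator S x \<partial>N)"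
        unfolding eq measure_def using g S by (simp add: emeasure_density)
      also have "(\<integral>\<^sup>+x. ennreal (g x) * indicator S x \<partial>N) = (\<integral>\<^sup>+x. ennreal (indicator S x * g x) \<partial>N)"
        by (intro nn_integral_cong) (simp split: split_indicator)
      also have "\<dots> = ennreal (LINT x|N. indicator S x * g x)"
        using integrable_mult_indicator[OF S int] by (intro nn_integral_eq_integral) (auto simp: nonneg)
      finally show ?thesis
        by (simp add: set_lebesgue_integral_def nonneg)
    qed
    then show "has_density M N X (\<lambda>x. complex_of_real (g x))"
      using X int by (simp add: has_density_def set_eq complex_of_real_integrable_eq)
  qed
qed


section \<open>Gamma function and distributions\<close>

text \<open>
  The order \<open>m\<close> of the matrices is \<open>CARD('n)\<close>. The determinant of a Hermitian positive definite
  matrix is a positive real, on which complex \<open>powr\<close> is the usual power.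
\<close>

definition cmv_Gamma :: "'n::{finite,wellorder} itself \<Rightarrow> complex \<Rightarrow> complex" where
  "cmv_Gamma _ a =
     (LINT V:{V :: complex^'n::{finite,wellorder}^'n::{finite,wellorder}. hpd V}|hermitian_measure.
        etr (- V) * det V powr (a - of_nat CARD('n)))"

definition cmv_beta_star :: "'n::{finite,wellorder} itself \<Rightarrow> complex \<Rightarrow> complex \<Rightarrow> complex \<Rightarrow> complex" where
  "cmv_beta_star n a b c =
     cmv_Gamma n a * cmv_Gamma n b * cmv_Gamma n c / cmv_Gamma n (a + b + c)"

definition cmv_gamma_density :: "complex \<Rightarrow> complex^'n::{finite,wellorder}^'n::{finite,wellorder} \<Rightarrow> complex" where
  "cmv_gamma_density a X =
     (if hpd X
      then 1 / cmv_Gamma TYPE('n) a * det X powr (a - of_nat CARD('n)) * etr (- X)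
      else 0)"

definition cmv_gamma_distributed ::
  "'w measure \<Rightarrow> complex \<Rightarrow> ('w \<Rightarrow> complex^'n::{finite,wellorder}^'n::{finite,wellorder}) \<Rightarrow> bool" where
  "cmv_gamma_distributed M a X \<longleftrightarrow> has_density M hermitian_measure X (cmv_gamma_density a)"

text \<open>The stacked matrix \<open>(F\<^sub>1 : F\<^sub>2)'\<close> is represented by the pair \<open>(F\<^sub>1, F\<^sub>2)\<close> of its blocks.\<close>

definition cbimatrix_beta_II ::
  "'w measure \<Rightarrow> complex \<Rightarrow> complex \<Rightarrow> complex \<Rightarrow>
   ('w \<Rightarrow> (complex^'n::{finite,wellorder}^'n::{finite,wellorder}) \<times> (complex^'n::{finite,wellorder}^'n::{finite,wellorder})) \<Rightarrow> bool" where
  "cbimatrix_beta_II M a b c F \<longleftrightarrow>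
     (\<exists>A B C.
        cmv_gamma_distributed M a A \<and>
        cmv_gamma_distributed M b B \<and>
        cmv_gamma_distributed M c C \<and>
        prob_space.indep_vars M (\<lambda>_. borel) (\<lambda>i. [A, B, C] ! i) {..<3} \<and>
        (\<forall>\<omega>\<in>space M. F \<omega> =
           (hpd_inv_sqrt (C \<omega>) ** A \<omega> ** hpd_inv_sqrt (C \<omega>),
            hpd_inv_sqrt (C \<omega>) ** B \<omega> ** hpd_inv_sqrt (C \<omega>))))"

end

theory Submission
  imports Defs
begin

text \<open>
  Write \<open>m\<close> for the order of the matrices. The joint density of the independent triple \<open>(C, A, B)\<close> is
  transformed to the variables \<open>(C, F\<^sub>1, F\<^sub>2)\<close> with \<open>A = C\<^bsup>1/2\<^esup> F\<^sub>1 C\<^bsup>1/2\<^esup>\<close> and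
  \<open>B = C\<^bsup>1/2\<^esup> F\<^sub>2 C\<^bsup>1/2\<^esup>\<close>, and \<open>C\<close> is integrated out. The determinants become
  \<open>|A| = |C| |F\<^sub>1|\<close> and \<open>|B| = |C| |F\<^sub>2|\<close>, the traces add up to \<open>tr (C (I + F\<^sub>1 + F\<^sub>2))\<close>, and the
  Jacobian is \<open>|C|\<^bsup>2m\<^esup>\<close>. What remains is, up to factors not depending on \<open>C\<close>, the integral of
  \<open>etr (- C G) |C|\<^bsup>s-m\<^esup>\<close> with \<open>G = I + F\<^sub>1 + F\<^sub>2\<close> and \<open>s = a + b + c\<close>. The same kind of
  substitution, with \<open>G\<^bsup>1/2\<^esup>\<close>, evaluates it as \<open>|G|\<^bsup>-s\<^esup>\<close> times the gamma function at \<open>s\<close>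
  (\<open>cmv_Gamma_laplace\<close>). The gamma factors are kept in the form of their defining integrals.

  Two ingredients carry this argument. First, the positive definite square root must exist, be unique, and
  its inverse must be a Borel function. Existence is a contraction argument (\<open>quadratic_fixed_point\<close>),
  uniqueness a trace identity (\<open>hpd_sqrt_unique\<close>), and measurability follows because the graph is a
  countable union of compact sets (\<open>borel_measurable_hpd_inv_sqrt\<close>). Second, the map
  \<open>X \<mapsto> T X T\<close> on Hermitian matrices must have Jacobian \<open>|T|\<^bsup>2m\<^esup>\<close> for positive definite \<open>T\<close>
  (\<open>hermitian_measure_congruence\<close>). The quotient of the two sides is multiplicative in
  \<open>T\<close> and equals 1 on positive diagonal matrices. It therefore equals 1 on the unipotent matrices of Gaussian
  elimination, which are conjugate to their own squares by positive diagonal matrices, and elimination reduces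
  every positive definite matrix to a diagonal one (\<open>character_hpd_eq_1\<close>).

  The parameters are complex, while a probability density is real. The hypotheses force
  the three gamma densities to be real and nonnegative almost everywhere (\<open>has_density_nonneg_real\<close>); this
  yields the product form of the joint density, and from there on all integrals are complex Bochner integrals.
\<close>

section \<open>Hermitian and positive definite matrices\<close>

text \<open>
  The quadratic form in the definition of \<^const>\<open>hpd\<close> is the real inner product of
  \<open>complex^'n\<close> as a Euclidean space, so norm and Cauchy--Schwarz estimates
  for Euclidean spaces apply to it directly.
\<close>

lemma inner_complex_vec: "Re (\<Sum>i\<in>UNIV. cnj (x $ i) * y $ i) = x \<bullet> (y :: complex^'n)"
  by (simp add: inner_vec_def inner_complex_def)

lemma hpd_iff: "hpd A \<longleftrightarrow> ctranspose A = A \<and> (\<forall>x. x \<noteq> 0 \<longrightarrow> 0 < x \<bullet> (A *v x))"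
  unfolding hpd_def inner_complex_vec ..

lemma hpd_hermitian: "hpd A \<Longrightarrow> ctranspose A = A"
  by (simp add: hpd_def)

lemma hpd_pos: "hpd A \<Longrightarrow> x \<noteq> 0 \<Longrightarrow> 0 < x \<bullet> (A *v x)"
  by (simp add: hpd_iff)

lemma hpd_nonneg: "hpd A \<Longrightarrow> 0 \<le> x \<bullet> (A *v x)"
  by (cases "x = 0") (auto dest: hpd_pos less_imp_le)

lemma ctranspose_ctranspose [simp]: "ctranspose (ctranspose A) = A"
  by (simp add: ctranspose_def vec_eq_iff)

lemma ctranspose_mult: "ctranspose (A ** B) = ctranspose B ** ctranspose A"
  by (simp add: ctranspose_def matrix_matrix_mult_def vec_eq_iff mult.commute)

lemma ctranspose_add: "ctranspose (A + B) = ctranspose A + ctranspose B"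
  by (simp add: ctranspose_def vec_eq_iff)

lemma ctranspose_diff: "ctranspose (A - B) = ctranspose A - ctranspose B"
  by (simp add: ctranspose_def vec_eq_iff)

lemma ctranspose_scaleR: "ctranspose (c *\<^sub>R A) = c *\<^sub>R ctranspose A"
  by (simp add: ctranspose_def vec_eq_iff)

lemma ctranspose_mat1 [simp]: "ctranspose (mat 1) = mat 1"
  by (simp add: ctranspose_def vec_eq_iff mat_def)

lemma det_ctranspose: "det (ctranspose A) = cnj (det (A :: complex^'n^'n))"
proof -
  have "det (ctranspose A) = det (\<chi> i j. cnj (transpose A $ i $ j))"
    by (simp add: ctranspose_def transpose_def)
  also have "\<dots> = cnj (det (transpose A))"
    by (simp add: det_def)
  finally show ?thesis by simp
qed

text \<open>
  The conjugate transpose is also the adjoint for the real inner product.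
\<close>

lemma inner_matrix_vector: "x \<bullet> (A *v y) = (ctranspose A *v x) \<bullet> y" for A :: "complex^'n^'m"
proof -
  have "(\<Sum>i\<in>UNIV. cnj (x$i) * (A *v y)$i) = (\<Sum>i\<in>UNIV. cnj ((ctranspose A *v x)$i) * y$i)"
    unfolding matrix_vector_mult_def ctranspose_def
    by (simp add: sum_distrib_left sum_distrib_right) (subst sum.swap, simp add: mult_ac)
  then show ?thesis
    unfolding inner_complex_vec[symmetric] by simp
qed

lemma bounded_linear_matrix_vector [simp]: "bounded_linear ((*v) A)" for A :: "complex^'n^'m"
proof -
  have "linear ((*v) A)"
    by (rule linearI)
      (simp_all add: vec_eq_iff matrix_vector_mult_def scaleR_sum_right distrib_left sum.distrib)
  then show ?thesis by (rule linear_conv_bounded_linear[THEN iffD1])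
qed

lemma continuous_on_matrix_vector [continuous_intros]:
  fixes A :: "'a::topological_space \<Rightarrow> complex^'n^'m"
  assumes "continuous_on S A" "continuous_on S x"
  shows "continuous_on S (\<lambda>t. A t *v x t)"
  unfolding matrix_vector_mult_def by (intro continuous_intros assms)

lemma continuous_on_matrix_matrix [continuous_intros]:
  fixes A :: "'a::topological_space \<Rightarrow> complex^'n^'m"
  assumes "continuous_on S A" "continuous_on S B"
  shows "continuous_on S (\<lambda>t. A t ** B t)"
  unfolding matrix_matrix_mult_def by (intro continuous_intros assms)

lemma continuous_on_ctranspose [continuous_intros]:
  assumes "continuous_on S A"
  shows "continuous_on S (\<lambda>t. ctranspose (A t))"
  unfolding ctranspose_def by (intro continuous_intros assms)

lemma continuous_on_det [continuous_intros]:
  fixes A :: "'a::topological_space \<Rightarrow> complex^'n^'n"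
  assumes "continuous_on S A"
  shows "continuous_on S (\<lambda>t. det (A t))"
  unfolding det_def by (intro continuous_intros assms)

lemma continuous_on_trace [continuous_intros]:
  fixes A :: "'a::topological_space \<Rightarrow> complex^'n^'n"
  assumes "continuous_on S A"
  shows "continuous_on S (\<lambda>t. trace (A t))"
  unfolding trace_def by (intro continuous_intros assms)

text \<open>
  Positive definiteness with an explicit lower bound \<open>e\<close> for the spectrum. Unlike \<^const>\<open>hpd\<close>
  this is a closed condition on \<open>A\<close>, and by compactness of the unit sphere every positive definite
  matrix satisfies it for some \<open>e > 0\<close>.
\<close>

definition hpd_ge :: "real \<Rightarrow> complex^'n^'n \<Rightarrow> bool" where
  "hpd_ge e A \<longleftrightarrow> ctranspose A = A \<and> (\<forall>x. e * (norm x)\<^sup>2 \<le> x \<bullet> (A *v x))"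

lemma hpd_ge_imp_hpd: "hpd_ge e A \<Longrightarrow> 0 < e \<Longrightarrow> hpd A"
  unfolding hpd_ge_def hpd_iff
  by (metis less_le_trans mult_pos_pos zero_less_norm_iff zero_less_power)

lemma hpd_imp_hpd_ge:
  fixes A :: "complex^'n^'n"
  assumes "hpd A" obtains e where "0 < e" "hpd_ge e A"
proof -
  have "\<exists>x\<in>sphere 0 1. \<forall>y\<in>sphere 0 1. x \<bullet> (A *v x) \<le> y \<bullet> (A *v (y::complex^'n))"
    by (intro continuous_attains_inf continuous_intros) auto
  then obtain x :: "complex^'n" where x: "norm x = 1"
    and min: "\<And>y. norm y = 1 \<Longrightarrow> x \<bullet> (A *v x) \<le> y \<bullet> (A *v y)"
    by auto
  have "x \<bullet> (A *v x) * (norm y)\<^sup>2 \<le> y \<bullet> (A *v y)" for y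
  proof (cases "y = 0")
    case False
    have "x \<bullet> (A *v x) \<le> sgn y \<bullet> (A *v sgn y)"
      using False by (intro min) (simp add: norm_sgn)
    also have "\<dots> = (y \<bullet> (A *v y)) / (norm y)\<^sup>2"
      by (simp add: sgn_div_norm linear_simps[OF bounded_linear_matrix_vector] power2_eq_square divide_inverse)
    finally show ?thesis using False by (simp add: pos_le_divide_eq)
  qed simp
  then have "hpd_ge (x \<bullet> (A *v x)) A"
    using assms by (simp add: hpd_ge_def hpd_iff)
  moreover have "0 < x \<bullet> (A *v x)"
    using x by (intro hpd_pos assms) auto
  ultimately show ?thesis using that by blast
qed

lemma hpd_mat1 [simp]: "hpd (mat 1)"
  by (simp add: hpd_iff)

lemma hpd_add: "hpd A \<Longrightarrow> hpd B \<Longrightarrow> hpd (A + B)"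
  by (simp add: hpd_iff ctranspose_add matrix_vector_mult_add_rdistrib inner_add_right add_pos_pos)

lemma hpd_invertible:
  fixes A :: "complex^'n^'n"
  assumes "hpd A" shows "invertible A"
proof -
  have "x = 0" if "A *v x = 0" for x
    using hpd_pos[OF assms, of x] that by auto
  then have "\<exists>B. B ** A = mat 1" by (simp add: matrix_left_invertible_ker)
  then show ?thesis by (simp add: invertible_left_inverse)
qed

lemma invertible_ctranspose: "invertible A \<Longrightarrow> invertible (ctranspose (A :: complex^'n^'n))"
  unfolding invertible_det_nz by (simp add: det_ctranspose)

lemma hpd_congruence:
  fixes A T :: "complex^'n^'n"
  assumes "hpd A" "invertible T"
  shows "hpd (T ** A ** ctranspose T)"
  unfolding hpd_iff
proof (intro conjI allI impI)
  show "ctranspose (T ** A ** ctranspose T) = T ** A ** ctranspose T"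
    by (simp add: ctranspose_mult hpd_hermitian assms matrix_mul_assoc)
  fix x :: "complex^'n" assume "x \<noteq> 0"
  moreover obtain S where "S ** ctranspose T = mat 1"
    using invertible_ctranspose[OF assms(2)] by (auto simp: invertible_def)
  ultimately have "ctranspose T *v x \<noteq> 0"
    by (metis matrix_vector_mul_assoc matrix_vector_mul_lid matrix_vector_mult_0_right)
  then have "0 < (ctranspose T *v x) \<bullet> (A *v (ctranspose T *v x))"
    by (rule hpd_pos[OF assms(1)])
  also have "\<dots> = x \<bullet> (T ** A ** ctranspose T *v x)"
    by (simp add: inner_matrix_vector[of x] ctranspose_mult hpd_hermitian assms
        flip: matrix_vector_mul_assoc)
  finally show "0 < x \<bullet> (T ** A ** ctranspose T *v x)" .
qed

lemma hpd_congruence_iff: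
  fixes A T :: "complex^'n^'n"
  assumes "ctranspose T = T" "invertible T"
  shows "hpd (T ** A ** T) \<longleftrightarrow> hpd A"
proof
  assume H: "hpd (T ** A ** T)"
  obtain S where S: "S ** T = mat 1" "T ** S = mat 1"
    using assms(2) by (auto simp: invertible_def)
  have cS: "ctranspose S = S"
  proof -
    have "T ** ctranspose S = mat 1" using S(1) assms(1) by (metis ctranspose_mult ctranspose_mat1)
    then show ?thesis using S by (metis matrix_mul_assoc matrix_mul_lid matrix_mul_rid)
  qed
  have "hpd (S ** (T ** A ** T) ** ctranspose S)"
    using S by (intro hpd_congruence H) (auto simp: invertible_def)
  also have "S ** (T ** A ** T) ** ctranspose S = (S ** T) ** A ** (T ** S)"
    by (simp add: cS matrix_mul_assoc)
  finally show "hpd A" by (simp add: S)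
qed (use hpd_congruence[of A T] assms in auto)

lemma hpd_square: "hpd B \<Longrightarrow> hpd (B ** B)" for B :: "complex^'n^'n"
  using hpd_congruence[of "mat 1" B] by (simp add: hpd_invertible hpd_hermitian)

lemma hpd_inverse:
  fixes A B :: "complex^'n^'n"
  assumes A: "hpd A" and AB: "A ** B = mat 1"
  shows "hpd B"
proof -
  have BA: "B ** A = mat 1" using AB by (simp add: matrix_left_right_inverse)
  have "ctranspose B ** A = mat 1"
    using AB A by (metis ctranspose_mult ctranspose_mat1 hpd_hermitian)
  then have "ctranspose B = B"
    using AB by (metis matrix_mul_assoc matrix_mul_lid matrix_mul_rid)
  moreover have "B ** A ** B = B" by (simp add: BA)
  ultimately show ?thesis
    using hpd_congruence[of A B] A AB BA by (metis invertible_def)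
qed


section \<open>The positive definite square root\<close>

text \<open>
  The norm of \<open>complex^'n^'m\<close> is the Frobenius norm. A factor that is bounded by \<open>r\<close> as an operator
  contracts it by \<open>r\<close>, from either side.
\<close>

lemma norm_matrix_power2: "(norm (A :: complex^'n^'m))\<^sup>2 = (\<Sum>i\<in>UNIV. \<Sum>j\<in>UNIV. (cmod (A $ i $ j))\<^sup>2)"
  by (simp add: norm_vec_def L2_set_def sum_nonneg)

lemma norm_ctranspose [simp]: "norm (ctranspose A) = norm (A :: complex^'n^'m)"
proof -
  have "(norm (ctranspose A))\<^sup>2 = (norm A)\<^sup>2"
    unfolding norm_matrix_power2 by (simp add: ctranspose_def) (rule sum.swap)
  then show ?thesis by simp
qed

lemma norm_matrix_columns: "(norm (A :: complex^'n^'m))\<^sup>2 = (\<Sum>j\<in>UNIV. (norm (column j A))\<^sup>2)"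
  unfolding norm_matrix_power2
  by (subst sum.swap) (simp add: norm_vec_def L2_set_def sum_nonneg column_def)

lemma column_mult: "column j (A ** B) = A *v column j B"
  by (simp add: column_def matrix_matrix_mult_def matrix_vector_mult_def)

lemma norm_matrix_mult_left:
  fixes Y :: "complex^'n^'m" and E :: "complex^'k^'n"
  assumes Y: "\<And>x. norm (Y *v x) \<le> r * norm x" and r: "0 \<le> r"
  shows "norm (Y ** E) \<le> r * norm E"
proof (rule power2_le_imp_le)
  have "(norm (Y ** E))\<^sup>2 \<le> (\<Sum>j\<in>UNIV. (r * norm (column j E))\<^sup>2)"
    unfolding norm_matrix_columns column_mult by (intro sum_mono power_mono Y) auto
  also have "\<dots> = (r * norm E)\<^sup>2"
    by (simp add: power_mult_distrib norm_matrix_columns[of E] sum_distrib_left)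
  finally show "(norm (Y ** E))\<^sup>2 \<le> (r * norm E)\<^sup>2" .
qed (use r in simp)

lemma norm_matrix_mult_right:
  fixes Z :: "complex^'n^'n" and E :: "complex^'n^'k"
  assumes Z: "\<And>x. norm (Z *v x) \<le> r * norm x" and r: "0 \<le> r" and h: "ctranspose Z = Z"
  shows "norm (E ** Z) \<le> r * norm E"
  using norm_matrix_mult_left[OF Z r, of "ctranspose E"] h
  by (metis ctranspose_mult ctranspose_ctranspose norm_ctranspose)

lemma matrix_mult_scaleR: "(c *\<^sub>R A) ** B = c *\<^sub>R (A ** B)" "A ** (c *\<^sub>R B) = c *\<^sub>R (A ** B)"
  for A :: "complex^'n^'m"
  by (simp_all add: matrix_matrix_mult_def vec_eq_iff scaleR_sum_right)

lemma matrix_vector_scaleR: "(c *\<^sub>R A) *v x = c *\<^sub>R (A *v x)" for A :: "complex^'n^'m"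
  by (simp add: matrix_vector_mult_def vec_eq_iff scaleR_sum_right)

lemma matrix_add_rdistrib: "(B + C) ** A = B ** A + C ** A" for A :: "complex^'n^'m"
  by (simp add: matrix_matrix_mult_def vec_eq_iff distrib_right sum.distrib)

lemmas matrix_distribs = matrix_add_ldistrib matrix_add_rdistrib

lemma matrix_sub_ldistrib: "A ** (B - C) = A ** B - A ** C" for A :: "complex^'n^'m"
  by (simp add: matrix_matrix_mult_def vec_eq_iff right_diff_distrib sum_subtractf)

lemma matrix_sub_rdistrib: "(B - C) ** A = B ** A - C ** A" for A :: "complex^'n^'m"
  by (simp add: matrix_matrix_mult_def vec_eq_iff left_diff_distrib sum_subtractf)

text \<open>
  Since \<open>X + Y\<^sup>2 = 2 Y\<close> says \<open>(1 - Y)\<^sup>2 = 1 - X\<close>, this is the square root of \<open>1 - X\<close>. The map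
  \<open>Y \<mapsto> (X + Y\<^sup>2) / 2\<close> preserves the Hermitian matrices with operator bound \<open>r\<close>, because
  \<open>(r + r\<^sup>2) / 2 \<le> r\<close>, and it contracts them by \<open>r\<close> in the Frobenius norm, because
  \<open>Y\<^sup>2 - Z\<^sup>2 = Y (Y - Z) + (Y - Z) Z\<close>.
\<close>

lemma quadratic_fixed_point:
  fixes X :: "complex^'n^'n"
  assumes h: "ctranspose X = X" and X: "\<And>x. norm (X *v x) \<le> r * norm x"
    and r: "0 \<le> r" "r < 1"
  shows "\<exists>Y. ctranspose Y = Y \<and> (\<forall>x. norm (Y *v x) \<le> r * norm x) \<and> X + Y ** Y = 2 *\<^sub>R Y"
proof -
  define S where "S = {Y :: complex^'n^'n. ctranspose Y = Y \<and> (\<forall>x. norm (Y *v x) \<le> r * norm x)}"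
  define f where "f Y = (1/2) *\<^sub>R (X + Y ** Y)" for Y :: "complex^'n^'n"
  have "closed S"
    unfolding S_def
    by (intro closed_Collect_conj closed_Collect_eq closed_Collect_all closed_Collect_le continuous_intros)
  then have "\<exists>!Y\<in>S. f Y = Y"
  proof (rule Banach_fix[OF complete_eq_closed[THEN iffD2]])
    show "S \<noteq> {}" using h X by (auto simp: S_def)
    show "f ` S \<subseteq> S"
    proof safe
      fix Y assume Y: "Y \<in> S"
      have "norm (f Y *v x) \<le> r * norm x" for x
      proof -
        have "norm (f Y *v x) \<le> (1/2) * (norm (X *v x) + norm (Y *v (Y *v x)))"
          by (simp add: f_def matrix_vector_scaleR matrix_vector_mult_add_rdistrib norm_triangle_ineq
              flip: matrix_vector_mul_assoc)
        also have "norm (Y *v (Y *v x)) \<le> r * (r * norm x)"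
        proof -
          have YY: "norm (Y *v z) \<le> r * norm z" for z using Y by (simp add: S_def)
          show ?thesis by (rule order_trans[OF YY mult_left_mono[OF YY r(1)]])
        qed
        also have "r * (r * norm x) \<le> 1 * (r * norm x)"
          using r by (intro mult_right_mono) auto
        finally show ?thesis using X[of x] by simp
      qed
      then show "f Y \<in> S"
        using Y h by (simp add: S_def f_def ctranspose_scaleR ctranspose_add ctranspose_mult)
    qed
    fix Y Z assume YZ: "Y \<in> S" "Z \<in> S"
    have "f Y - f Z = (1/2) *\<^sub>R (Y ** (Y - Z) + (Y - Z) ** Z)"
      by (simp add: f_def matrix_sub_ldistrib matrix_sub_rdistrib algebra_simps)
    then have "norm (f Y - f Z) \<le> (1/2) * (norm (Y ** (Y - Z)) + norm ((Y - Z) ** Z))"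
      by (simp add: norm_triangle_ineq)
    also have "\<dots> \<le> (1/2) * (r * norm (Y - Z) + r * norm (Y - Z))"
      using YZ r unfolding S_def
      by (intro mult_left_mono add_mono norm_matrix_mult_left norm_matrix_mult_right) auto
    finally show "dist (f Y) (f Z) \<le> r * dist Y Z" by (simp add: dist_norm)
  qed (use r in auto)
  then obtain Y where "Y \<in> S" and fY: "f Y = Y" by blast
  moreover have "X + Y ** Y = 2 *\<^sub>R Y"
  proof -
    have "2 *\<^sub>R f Y = X + Y ** Y" by (simp add: f_def)
    then show ?thesis by (simp add: fY)
  qed
  ultimately show ?thesis unfolding S_def by blast
qed

text \<open>
  A small multiple \<open>t A\<close> is so close to the identity that \<open>X = 1 - t A\<close> has operator bound less than 1:
  with \<open>e |x|\<^sup>2 \<le> x \<bullet> A x\<close> and \<open>|A x| \<le> L |x|\<close> one has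
  \<open>|X x|\<^sup>2 \<le> (1 - 2 t e + t\<^sup>2 L\<^sup>2) |x|\<^sup>2\<close>. The fixed point above then gives a root of \<open>t A\<close>.
\<close>

lemma hpd_sqrt_exists:
  fixes A :: "complex^'n^'n"
  assumes A: "hpd A"
  obtains B where "hpd B" "B ** B = A"
proof -
  obtain e where e: "0 < e" "hpd_ge e A" using hpd_imp_hpd_ge[OF A] .
  obtain K where K: "0 < K" "\<And>x. norm (A *v x) \<le> norm x * K"
    using bounded_linear.pos_bounded[OF bounded_linear_matrix_vector, of A] by blast
  \<comment> \<open>the strict bound \<open>e < L\<close> makes \<open>1 - (e / L)\<^sup>2\<close>, the square of the radius \<open>r\<close>, positive\<close>
  define L where "L = max K (e + 1)"
  have L: "0 < L" "e < L" "norm (A *v x) \<le> L * norm x" for x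
    using K e(1) order_trans[OF K(2)[of x] mult_left_mono[of K L "norm x"]]
    by (auto simp: L_def mult.commute)
  \<comment> \<open>the minimiser of \<open>1 - 2 t e + t\<^sup>2 L\<^sup>2\<close>, whose minimum is \<open>r\<^sup>2\<close>\<close>
  define t where "t = e / L\<^sup>2"
  have t: "0 < t" using e L by (simp add: t_def)
  define r where "r = sqrt (1 - (e / L)\<^sup>2)"
  have eL: "0 < e / L" "e / L < 1" using e L by simp_all
  then have eL2: "0 < (e/L)\<^sup>2" "(e/L)\<^sup>2 < 1" by (auto simp: power_less_one_iff)
  have r: "0 \<le> r" "r < 1" "r\<^sup>2 = 1 - (e/L)\<^sup>2"
    unfolding r_def using eL2 by (auto simp: real_less_lsqrt)
  define X where "X = mat 1 - t *\<^sub>R A"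
  have hX: "ctranspose X = X"
    by (simp add: X_def ctranspose_diff ctranspose_scaleR hpd_hermitian[OF A])
  have nX: "norm (X *v x) \<le> r * norm x" for x
  proof (rule power2_le_imp_le)
    have "(norm (X *v x))\<^sup>2 = (norm x)\<^sup>2 - 2 * t * (x \<bullet> (A *v x)) + t\<^sup>2 * (norm (A *v x))\<^sup>2"
      unfolding power2_norm_eq_inner
      by (simp add: X_def matrix_vector_mult_diff_rdistrib matrix_vector_scaleR
          inner_diff_left inner_diff_right inner_commute power2_eq_square algebra_simps)
    also have "\<dots> \<le> (norm x)\<^sup>2 - 2 * t * (e * (norm x)\<^sup>2) + t\<^sup>2 * (L * norm x)\<^sup>2"
      using e t L(3)[of x] unfolding hpd_ge_def
      by (intro add_mono diff_mono mult_left_mono power_mono) auto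
    also have "\<dots> = (norm x)\<^sup>2 * (1 - 2 * t * e + t\<^sup>2 * L\<^sup>2)"
      by (simp add: algebra_simps power_mult_distrib)
    also have "1 - 2 * t * e + t\<^sup>2 * L\<^sup>2 = r\<^sup>2"
      unfolding r(3) t_def using L by (simp add: field_simps power2_eq_square)
    finally show "(norm (X *v x))\<^sup>2 \<le> (r * norm x)\<^sup>2" by (simp add: power_mult_distrib mult.commute)
  qed (use r in simp)
  obtain Y where Y: "ctranspose Y = Y" "\<And>x. norm (Y *v x) \<le> r * norm x" "X + Y ** Y = 2 *\<^sub>R Y"
    using quadratic_fixed_point[OF hX nX r(1,2)] by blast
  define B where "B = (1 / sqrt t) *\<^sub>R (mat 1 - Y)"
  have "(mat 1 - Y) ** (mat 1 - Y) = mat 1 - 2 *\<^sub>R Y + Y ** Y"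
    by (simp add: matrix_sub_ldistrib matrix_sub_rdistrib scaleR_2)
  also have "\<dots> = t *\<^sub>R A"
    using Y(3) by (simp add: X_def algebra_simps)
  finally have "B ** B = A"
    using t by (simp add: B_def matrix_mult_scaleR)
  moreover have "hpd B"
    unfolding hpd_iff
  proof (intro conjI allI impI)
    show "ctranspose B = B" by (simp add: B_def ctranspose_scaleR ctranspose_diff Y)
    fix x :: "complex^'n" assume x: "x \<noteq> 0"
    have "x \<bullet> (Y *v x) \<le> norm x * (r * norm x)"
      by (rule order_trans[OF norm_cauchy_schwarz mult_left_mono[OF Y(2)]]) simp
    also have "\<dots> < norm x * norm x"
      using x r by simp
    finally have "0 < x \<bullet> ((mat 1 - Y) *v x)"
      by (simp add: matrix_vector_mult_diff_rdistrib inner_diff_right dot_square_norm power2_eq_square)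
    then show "0 < x \<bullet> (B *v x)"
      using t by (simp add: B_def matrix_vector_scaleR)
  qed
  ultimately show ?thesis using that by blast
qed

text \<open>
  Such a trace is nonnegative for positive definite \<open>B\<close>, and zero only if \<open>E = 0\<close>.
\<close>

lemma Re_trace_ctranspose_mult:
  "Re (trace (ctranspose E ** B ** E)) = (\<Sum>j\<in>UNIV. column j E \<bullet> (B *v column j E))"
  for B :: "complex^'n^'n" and E :: "complex^'k^'n"
proof -
  have "(ctranspose E ** B ** E) $ j $ j = (\<Sum>i\<in>UNIV. cnj (column j E $ i) * (B *v column j E) $ i)" for j
    unfolding matrix_mul_assoc[symmetric]
    by (simp add: matrix_matrix_mult_def ctranspose_def column_def matrix_vector_mult_def)
  then show ?thesis by (simp add: trace_def flip: inner_complex_vec)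
qed

text \<open>
  The difference \<open>E = B - D\<close> of two roots satisfies \<open>B E + E D = B\<^sup>2 - D\<^sup>2 = 0\<close>. Multiplying by \<open>E\<close> and
  taking the trace gives two nonnegative terms \<open>tr (E B E)\<close> and \<open>tr (E D E)\<close> with sum zero.
\<close>

lemma hpd_sqrt_unique:
  fixes B D :: "complex^'n^'n"
  assumes "hpd B" "hpd D" and eq: "B ** B = D ** D"
  shows "B = D"
proof -
  define E where "E = B - D"
  have hE: "ctranspose E = E"
    using assms by (simp add: E_def ctranspose_diff hpd_hermitian)
  have "B ** E + E ** D = 0"
    by (simp add: E_def matrix_sub_ldistrib matrix_sub_rdistrib eq)
  then have "trace (E ** (B ** E + E ** D)) = 0" by (simp add: trace_def)
  then have "trace (E ** B ** E) + trace (E ** E ** D) = 0"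
    by (simp add: matrix_distribs trace_add matrix_mul_assoc)
  also have "trace (E ** E ** D) = trace (E ** D ** E)"
    by (metis matrix_mul_assoc trace_mul_sym)
  finally have "Re (trace (ctranspose E ** B ** E)) + Re (trace (ctranspose E ** D ** E)) = 0"
    by (simp add: hE flip: plus_complex.sel)
  moreover have "0 \<le> Re (trace (ctranspose E ** D ** E))"
    unfolding Re_trace_ctranspose_mult by (intro sum_nonneg hpd_nonneg assms)
  ultimately have "(\<Sum>j\<in>UNIV. column j E \<bullet> (B *v column j E)) \<le> 0"
    unfolding Re_trace_ctranspose_mult by simp
  then have "column j E \<bullet> (B *v column j E) = 0" for j
    using sum_nonneg_eq_0_iff[of UNIV "\<lambda>j. column j E \<bullet> (B *v column j E)"]
      hpd_nonneg[OF assms(1)] sum_nonneg[of UNIV "\<lambda>j. column j E \<bullet> (B *v column j E)"] by force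
  then have "column j E = 0" for j
    using hpd_pos[OF assms(1), of "column j E"] by fastforce
  then have "E = 0" by (simp add: vec_eq_iff column_def)
  then show ?thesis by (simp add: E_def)
qed

lemma hpd_sqrt_eq: "hpd B \<Longrightarrow> B ** B = A \<Longrightarrow> hpd_sqrt A = B" for B :: "complex^'n^'n"
  unfolding hpd_sqrt_def by (rule the_equality) (auto intro: hpd_sqrt_unique)

lemma hpd_sqrt:
  fixes A :: "complex^'n^'n"
  assumes "hpd A" shows "hpd (hpd_sqrt A)" "hpd_sqrt A ** hpd_sqrt A = A"
  by (metis hpd_sqrt_exists[OF assms] hpd_sqrt_eq)+

lemma matrix_inv_eq: "A ** B = mat 1 \<Longrightarrow> matrix_inv A = B" for A :: "complex^'n^'n"
  unfolding matrix_inv_def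
  by (rule some_equality)
    (metis matrix_left_right_inverse, metis matrix_mul_assoc matrix_mul_lid matrix_mul_rid)

lemma hpd_inv_sqrt:
  fixes A :: "complex^'n^'n"
  assumes A: "hpd A"
  shows "hpd (hpd_inv_sqrt A)"
    and "hpd_sqrt A ** hpd_inv_sqrt A = mat 1" "hpd_inv_sqrt A ** hpd_sqrt A = mat 1"
proof -
  show 1: "hpd_sqrt A ** hpd_inv_sqrt A = mat 1" "hpd_inv_sqrt A ** hpd_sqrt A = mat 1"
    unfolding hpd_inv_sqrt_def using hpd_invertible[OF hpd_sqrt(1)[OF A]] matrix_inv_eq
    by (auto simp: invertible_def)
  show "hpd (hpd_inv_sqrt A)" using hpd_inverse[OF hpd_sqrt(1)[OF A] 1(1)] .
qed

text \<open>
  An algebraic description of the graph of the inverse square root that avoids the square root itself; it is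
  what makes the graph accessible to topology.
\<close>

lemma hpd_inv_sqrt_eq_iff:
  fixes A S :: "complex^'n^'n"
  assumes "hpd S"
  shows "hpd A \<and> hpd_inv_sqrt A = S \<longleftrightarrow> S ** A ** S = mat 1"
proof
  assume "hpd A \<and> hpd_inv_sqrt A = S"
  then show "S ** A ** S = mat 1"
    by (metis hpd_inv_sqrt(2,3) hpd_sqrt(2) matrix_mul_assoc matrix_mul_rid)
next
  assume eq: "S ** A ** S = mat 1"
  obtain B where B: "S ** B = mat 1" "B ** S = mat 1"
    using hpd_invertible[OF assms] by (auto simp: invertible_def)
  have "hpd B" using hpd_inverse[OF assms B(1)] .
  have "B ** B = B ** (S ** A ** S) ** B" by (simp add: eq)
  also have "\<dots> = (B ** S) ** A ** (S ** B)" by (simp add: matrix_mul_assoc)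
  finally have BB: "B ** B = A" by (simp add: B)
  then show "hpd A \<and> hpd_inv_sqrt A = S"
    using \<open>hpd B\<close> B hpd_square[of B] hpd_sqrt_eq[of B A] matrix_inv_eq[of B S]
    by (simp add: hpd_inv_sqrt_def)
qed

text \<open>
  Off the positive definite matrices the defining description is the constantly false predicate, so that the
  value there, although arbitrary, does not vary with \<open>A\<close>.
\<close>

lemma hpd_sqrt_not_hpd: "\<not> hpd A \<Longrightarrow> hpd_sqrt A = (THE B. False)" for A :: "complex^'n^'n"
  unfolding hpd_sqrt_def by (rule arg_cong[where f=The]) (auto simp: fun_eq_iff hpd_square)

text \<open>
  The determinant of the Hermitian square root is real and nonzero, and \<open>|A|\<close> is its square.
\<close>

lemma hpd_det:
  fixes A :: "complex^'n^'n"
  assumes A: "hpd A" shows "0 < Re (det A)" "det A = of_real (Re (det A))"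
proof -
  define B where "B = hpd_sqrt A"
  have B: "hpd B" "B ** B = A" unfolding B_def by (rule hpd_sqrt[OF A])+
  have "cnj (det B) = det B"
    using det_ctranspose[of B] B by (simp add: hpd_hermitian)
  then have r: "det B = of_real (Re (det B))" by (simp add: complex_eq_iff)
  have nz: "det B \<noteq> 0" using hpd_invertible[OF B(1)] by (simp add: invertible_det_nz)
  have "det A = of_real ((Re (det B))\<^sup>2)"
    using r by (metis B(2) det_mul of_real_mult power2_eq_square)
  moreover have "Re (det B) \<noteq> 0" using r nz by auto
  ultimately show "0 < Re (det A)" "det A = of_real (Re (det A))" by simp_all
qed

section \<open>Measurability of the inverse square root\<close>

lemma hpd_eq_Union_hpd_ge: 
  "{A :: complex^'n^'n. hpd A} = (\<Union>k. {A. hpd_ge (1 / Suc k) A})"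
proof safe
  fix A :: "complex^'n^'n" assume "hpd A"
  then obtain e where e: "0 < e" "hpd_ge e A" by (rule hpd_imp_hpd_ge)
  obtain k where "1 / Suc k < e" using e(1) nat_approx_posE by blast
  then have "hpd_ge (1 / Suc k) A"
    using e(2) unfolding hpd_ge_def by (meson less_imp_le mult_right_mono order_trans zero_le_power2)
  then show "A \<in> (\<Union>k. {A. hpd_ge (1 / Suc k) A})" by blast
next
  fix A :: "complex^'n^'n" and k assume "hpd_ge (1 / Suc k) A"
  then show "hpd A" by (rule hpd_ge_imp_hpd) simp
qed

lemma closed_hpd_ge: "closed {A :: complex^'n^'n. hpd_ge e A}"
  unfolding hpd_ge_def
  by (intro closed_Collect_conj closed_Collect_eq closed_Collect_all closed_Collect_le continuous_intros)

lemma hpd_sets [measurable]: "{A :: complex^'n^'n. hpd A} \<in> sets borel"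
  unfolding hpd_eq_Union_hpd_ge by (intro sets.countable_UN'' borel_closed closed_hpd_ge) auto

lemma hpd_measurable [measurable]: "Measurable.pred borel (hpd :: complex^'n^'n \<Rightarrow> bool)"
  by (simp add: pred_def)

text \<open>
  A closed set in a Euclidean space is a countable union of compact sets, and so is its projection.
\<close>

lemma borel_fst_image_closed:
  fixes R :: "('a::euclidean_space \<times> 'b::euclidean_space) set"
  assumes "closed R" shows "fst ` R \<in> sets borel"
proof -
  have "fst ` R = (\<Union>k::nat. fst ` (R \<inter> cball 0 (real k)))"
    using real_arch_simple by (fastforce simp: image_iff)
  also have "\<dots> \<in> sets borel"
  proof (intro sets.countable_UN'')
    fix k
    have "compact (fst ` (R \<inter> cball 0 (real k)))"
      by (intro compact_continuous_image continuous_intros closed_Int_compact assms compact_cball)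
    then show "fst ` (R \<inter> cball 0 (real k)) \<in> sets borel" by (intro borel_closed compact_imp_closed)
  qed auto
  finally show ?thesis .
qed

text \<open>
  On positive definite matrices the preimage of a closed set \<open>K\<close> is the projection of the set of pairs
  \<open>(A, S)\<close> with \<open>S \<in> K\<close> positive definite and \<open>S A S = 1\<close>. Bounding the spectrum of \<open>S\<close> below by \<open>1 / k\<close>
  exhausts this set by closed ones.
\<close>

lemma borel_measurable_hpd_inv_sqrt [measurable]:
  "(hpd_inv_sqrt :: complex^'n^'n \<Rightarrow> _) \<in> borel_measurable borel"
proof -
  define d where "d = matrix_inv (THE B :: complex^'n^'n. False)"
  have off: "hpd_inv_sqrt A = d" if "\<not> hpd A" for A :: "complex^'n^'n"
    using hpd_sqrt_not_hpd[OF that] by (simp add: hpd_inv_sqrt_def d_def)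
  have *: "{A. hpd A \<and> hpd_inv_sqrt A \<in> K} \<in> sets borel" if K: "closed K" for K :: "(complex^'n^'n) set"
  proof -
    have "{A. hpd A \<and> hpd_inv_sqrt A \<in> K} =
      (\<Union>k. fst ` {p. snd p \<in> K \<and> hpd_ge (1 / Suc k) (snd p) \<and> snd p ** fst p ** snd p = mat 1})"
      (is "?L = ?R")
    proof safe
      fix A :: "complex^'n^'n" assume A: "hpd A" "hpd_inv_sqrt A \<in> K"
      have "hpd_inv_sqrt A \<in> {S. hpd S}" using hpd_inv_sqrt(1)[OF A(1)] by simp
      then obtain k where "hpd_ge (1 / Suc k) (hpd_inv_sqrt A)"
        unfolding hpd_eq_Union_hpd_ge by blast
      moreover have "hpd_inv_sqrt A ** A ** hpd_inv_sqrt A = mat 1"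
        using A hpd_inv_sqrt(1)[OF A(1)] hpd_inv_sqrt_eq_iff by blast
      ultimately show "A \<in> ?R" using A(2) by (intro UN_I[of k] image_eqI[of _ _ "(A, hpd_inv_sqrt A)"]) auto
    next
      fix k A and S :: "complex^'n^'n"
      assume S: "snd (A, S) \<in> K" "hpd_ge (1 / Suc k) (snd (A, S))" "snd (A, S) ** fst (A, S) ** snd (A, S) = mat 1"
      then have "hpd S" by (intro hpd_ge_imp_hpd[of "1 / Suc k"]) auto
      then have "hpd A \<and> hpd_inv_sqrt A = S" using S(3) by (simp add: hpd_inv_sqrt_eq_iff)
      then show "hpd (fst (A, S))" "hpd_inv_sqrt (fst (A, S)) \<in> K" using S(1) by auto
    qed
    also have "\<dots> \<in> sets borel"
    proof (intro sets.countable_UN'')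
      fix k :: nat
      have "closed (snd -` {A :: complex^'n^'n. hpd_ge (1 / Suc k) A} :: ((complex^'n^'n) \<times> _) set)"
        by (intro closed_vimage_snd closed_hpd_ge)
      moreover have "closed (snd -` K :: ((complex^'n^'n) \<times> _) set)"
        by (intro closed_vimage_snd K)
      moreover have "closed {p :: (complex^'n^'n) \<times> (complex^'n^'n). snd p ** fst p ** snd p = mat 1}"
        by (intro closed_Collect_eq continuous_intros)
      ultimately have "closed (snd -` K \<inter> snd -` {A. hpd_ge (1 / Suc k) A} \<inter>
          {p :: (complex^'n^'n) \<times> (complex^'n^'n). snd p ** fst p ** snd p = mat 1})"
        by (intro closed_Int)
      also have "\<dots> = {p. snd p \<in> K \<and> hpd_ge (1 / Suc k) (snd p) \<and> snd p ** fst p ** snd p = mat 1}"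
        by auto
      finally show "fst ` \<dots> \<in> sets borel" by (rule borel_fst_image_closed)
    qed auto
    finally show ?thesis .
  qed
  show ?thesis
  proof (rule borel_measurableI)
    fix U :: "(complex^'n^'n) set" assume U: "open U"
    have "hpd_inv_sqrt -` U \<inter> space borel =
      ({A. hpd A} - {A. hpd A \<and> hpd_inv_sqrt A \<in> - U}) \<union> (if d \<in> U then - {A. hpd A} else {})"
      using off by auto
    also have "\<dots> \<in> sets borel"
      using *[of "- U"] U by (auto intro!: sets.Un sets.Diff borel_comp)
    finally show "hpd_inv_sqrt -` U \<inter> space borel \<in> sets borel" .
  qed
qed

section \<open>Real coordinates of Hermitian matrices\<close>

text \<open>
  A Hermitian matrix of order \<open>m\<close> has \<open>m\<^sup>2\<close> free real coordinates. They are indexed by all pairs of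
  indices: a pair on or above the diagonal stands for a real part, a pair below it for the imaginary part
  of the transposed entry. The lexicographic order makes the index type well-ordered, as the
  determinant formula for the volume of linear images in \<open>real^'k\<close> requires; a separate type keeps it apart
  from the componentwise order of pairs.
\<close>

datatype 'n coord = Coord (row: 'n) (col: 'n)

instance coord :: (finite) finite
proof
  have "(UNIV :: 'a coord set) = range (\<lambda>(i, j). Coord i j)"
    by (metis (no_types, lifting) UNIV_eq_I case_prod_conv coord.exhaust rangeI)
  then show "finite (UNIV :: 'a coord set)" by (metis finite finite_imageI)
qed

instantiation coord :: (wellorder) wellorder
begin

definition less_eq_coord :: "'a coord \<Rightarrow> 'a coord \<Rightarrow> bool" where
  "less_eq_coord p q \<longleftrightarrow> row p < row q \<or> row p = row q \<and> col p \<le> col q"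

definition less_coord :: "'a coord \<Rightarrow> 'a coord \<Rightarrow> bool" where
  "less_coord p q \<longleftrightarrow> row p < row q \<or> row p = row q \<and> col p < col q"

instance
proof
  fix P :: "'a coord \<Rightarrow> bool" and a
  assume step: "\<And>x. (\<And>y. y < x \<Longrightarrow> P y) \<Longrightarrow> P x"
  have "\<forall>j. P (Coord i j)" for i
  proof (induction i rule: less_induct)
    case outer: (less i)
    have "P (Coord i j)" for j
    proof (induction j rule: less_induct)
      case inner: (less j)
      show ?case
      proof (rule step)
        fix y assume "y < Coord i j"
        then have "row y < i \<or> row y = i \<and> col y < j" by (simp add: less_coord_def)
        then have "P (Coord (row y) (col y))" using outer inner by blast
        then show "P y" by simp
      qed
    qed
    then show ?case by blast
  qed
  then show "P a" by (cases a) auto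
qed (auto simp: less_eq_coord_def less_coord_def coord.expand)

end

lemma prod_coord: "(\<Prod>p\<in>UNIV. f p) = (\<Prod>i\<in>UNIV. \<Prod>j\<in>UNIV. f (Coord i j))"
proof -
  have "bij (\<lambda>(i, j). Coord i j)"
    by (rule bij_betwI[where g = "\<lambda>p. (row p, col p)"]) auto
  then have "(\<Prod>p\<in>UNIV. f p) = (\<Prod>p\<in>UNIV. f ((\<lambda>(i, j). Coord i j) p))"
    by (rule prod.reindex_bij_betw[symmetric])
  also have "\<dots> = (\<Prod>p\<in>UNIV \<times> UNIV. f (Coord (fst p) (snd p)))"
    by (simp add: case_prod_unfold)
  finally show ?thesis by (simp add: prod.cartesian_product case_prod_unfold)
qed

text \<open>
  The Hermitian matrix with given coordinates; \<open>coords\<close> below is its left inverse on all matrices.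
\<close>

definition herm :: "real^('n::{finite,wellorder}) coord \<Rightarrow> complex^'n::{finite,wellorder}^'n::{finite,wellorder}" where
  "herm v = (\<chi> r s. if r = s then of_real (v $ Coord r r)
     else if r < s then Complex (v $ Coord r s) (v $ Coord s r)
     else Complex (v $ Coord s r) (- v $ Coord r s))"

definition coords :: "complex^'n::{finite,wellorder}^'n::{finite,wellorder} \<Rightarrow> real^('n::{finite,wellorder}) coord" where
  "coords A = (\<chi> p. if row p \<le> col p then Re (A $ row p $ col p) else Im (A $ col p $ row p))"

lemma coords_herm [simp]: "coords (herm v) = v"
proof -
  have "coords (herm v) $ Coord r s = v $ Coord r s" for r s
    by (cases r s rule: linorder_cases) (auto simp: coords_def herm_def)
  then show ?thesis by (metis coord.collapse vec_eq_iff)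
qed

lemma ctranspose_herm [simp]: "ctranspose (herm v) = herm v"
  by (auto simp: ctranspose_def herm_def vec_eq_iff complex_eq_iff)

lemma herm_coords: 
  assumes "ctranspose A = A" shows "herm (coords A) = A"
proof -
  have "A $ r $ s = cnj (A $ s $ r)" for r s
    using assms by (simp add: ctranspose_def vec_eq_iff)
  then have 1: "Re (A $ r $ s) = Re (A $ s $ r)" "Im (A $ r $ s) = - Im (A $ s $ r)" for r s
    by (metis complex_cnj complex.sel complex_surj)+
  have "Im (A $ r $ r) = 0" for r using 1(2)[of r r] by simp
  then have "herm (coords A) $ r $ s = A $ r $ s" for r s
    using 1(1)[of r s] 1(2)[of r s]
    by (cases r s rule: linorder_cases) (auto simp: coords_def herm_def complex_eq_iff)
  then show ?thesis by (simp add: vec_eq_iff)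
qed

lemma linear_herm: "linear herm"
  by (rule linearI) (auto simp: herm_def vec_eq_iff complex_eq_iff algebra_simps)

lemma linear_coords: "linear coords"
  by (rule linearI) (auto simp: coords_def vec_eq_iff)

lemma borel_measurable_linear: "linear f \<Longrightarrow> f \<in> borel_measurable borel"
  for f :: "'a::euclidean_space \<Rightarrow> 'b::euclidean_space"
  by (simp add: borel_measurable_continuous_onI linear_continuous_on linear_conv_bounded_linear)

lemma herm_measurable [measurable]: "herm \<in> borel_measurable borel"
  by (rule borel_measurable_linear[OF linear_herm])

lemma coords_measurable [measurable]: "coords \<in> borel_measurable borel"
  by (rule borel_measurable_linear[OF linear_coords])

lemma prod_Basis_vec: "(\<Prod>b\<in>Basis. f b) = (\<Prod>i\<in>UNIV. f (axis i 1 :: real^'k))"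
proof -
  have B: "(Basis :: (real^'k) set) = range (\<lambda>i. axis i 1)"
    by (auto simp: Basis_vec_def)
  show ?thesis
    unfolding B by (subst prod.reindex) (simp_all add: inj_on_def axis_eq_axis)
qed

lemma lborel_vec_eqI:
  fixes M :: "(real^'k) measure"
  assumes "\<And>l u. (\<And>i. l $ i \<le> u $ i) \<Longrightarrow> emeasure M (box l u) = ennreal (\<Prod>i\<in>UNIV. u $ i - l $ i)"
    and "sets M = sets borel"
  shows "lborel = M"
proof (rule lborel_eqI)
  fix l u :: "real^'k" assume le: "\<And>b. b \<in> Basis \<Longrightarrow> l \<bullet> b \<le> u \<bullet> b"
  have "l $ i \<le> u $ i" for i
    using le[of "axis i 1"] by (simp add: inner_axis axis_in_Basis_iff)
  then show "emeasure M (box l u) = ennreal (\<Prod>b\<in>Basis. (u - l) \<bullet> b)"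
    using assms(1)[of l u] by (simp add: prod_Basis_vec inner_axis)
qed (use assms in simp)

lemma emeasure_lborel_vec_box:
  fixes l u :: "real^'k"
  assumes "\<And>i. l $ i \<le> u $ i"
  shows "emeasure lborel (box l u) = ennreal (\<Prod>i\<in>UNIV. u $ i - l $ i)"
proof -
  have "l \<bullet> b \<le> u \<bullet> b" if "b \<in> Basis" for b
    using that assms by (auto simp: Basis_vec_def inner_axis)
  then show ?thesis by (simp add: emeasure_lborel_box prod_Basis_vec inner_axis)
qed

lemma borel_measurable_vec:
  fixes f :: "'a \<Rightarrow> real^'k"
  assumes "\<And>i. (\<lambda>x. f x $ i) \<in> borel_measurable M"
  shows "f \<in> borel_measurable M"
  unfolding borel_measurable_euclidean_space[of f] Basis_vec_def
  using assms by (auto simp: inner_axis)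

definition merge_coords :: "('n::{finite,wellorder} \<times> 'n::{finite,wellorder} \<Rightarrow> real) \<times> ('n::{finite,wellorder} \<times> 'n::{finite,wellorder} \<Rightarrow> real) \<Rightarrow> real^('n::{finite,wellorder}) coord" where
  "merge_coords = (\<lambda>(x, y). \<chi> p. if row p \<le> col p then x (row p, col p) else y (col p, row p))"

lemma hermitian_of_coords_eq: "hermitian_of_coords xy = herm (merge_coords xy)"
  by (cases xy) (auto simp: hermitian_of_coords_def herm_def merge_coords_def vec_eq_iff complex_eq_iff)

lemma merge_coords_measurable [measurable]:
  "merge_coords \<in> measurable ((\<Pi>\<^sub>M p\<in>{(r::'n::{finite,wellorder}, s). r \<le> s}. lborel) \<Otimes>\<^sub>M (\<Pi>\<^sub>M p\<in>{(r, s). r < s}. lborel)) borel"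
  (is "_ \<in> measurable (?M \<Otimes>\<^sub>M ?N) _")
proof (rule borel_measurable_vec)
  fix p :: "'n coord"
  show "(\<lambda>xy. merge_coords xy $ p) \<in> borel_measurable (?M \<Otimes>\<^sub>M ?N)"
  proof (cases "row p \<le> col p")
    case True
    then have "(\<lambda>xy. fst xy (row p, col p)) \<in> borel_measurable (?M \<Otimes>\<^sub>M ?N)"
      by (intro measurable_compose[OF measurable_fst]) (simp add: measurable_component_singleton[of _ _ "\<lambda>_. lborel", simplified])
    with True show ?thesis by (simp add: merge_coords_def case_prod_unfold)
  next
    case False
    then have "(\<lambda>xy. snd xy (col p, row p)) \<in> borel_measurable (?M \<Otimes>\<^sub>M ?N)"
      by (intro measurable_compose[OF measurable_snd]) (simp add: measurable_component_singleton[of _ _ "\<lambda>_. lborel", simplified])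
    with False show ?thesis by (simp add: merge_coords_def case_prod_unfold)
  qed
qed

lemma lborel_eq_distr_merge_coords:
  "lborel = distr ((\<Pi>\<^sub>M p\<in>{(r::'n::{finite,wellorder}, s). r \<le> s}. lborel) \<Otimes>\<^sub>M (\<Pi>\<^sub>M p\<in>{(r, s). r < s}. lborel)) borel merge_coords"
  (is "_ = distr (?M \<Otimes>\<^sub>M ?N) borel _")
proof (rule lborel_vec_eqI)
  have P: "product_sigma_finite (\<lambda>_ :: 'n \<times> 'n. lborel :: real measure)"
    by (intro product_sigma_finite.intro sigma_finite_lborel)
  interpret N: sigma_finite_measure ?N
    by (rule product_sigma_finite.sigma_finite[OF P]) simp
  fix l u :: "real^'n coord" assume le: "\<And>i. l $ i \<le> u $ i"
  let ?X = "\<Pi>\<^sub>E p\<in>{(r, s). r \<le> s}. {l $ Coord (fst p) (snd p)<..<u $ Coord (fst p) (snd p)}"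
  let ?Y = "\<Pi>\<^sub>E p\<in>{(r, s). r < s}. {l $ Coord (snd p) (fst p)<..<u $ Coord (snd p) (fst p)}"
  have all_coord: "(\<forall>p. Q p) \<longleftrightarrow> (\<forall>r s. Q (Coord r s))" for Q :: "'n coord \<Rightarrow> bool"
    by (metis coord.collapse)
  have "(x, y) \<in> merge_coords -` box l u \<inter> space (?M \<Otimes>\<^sub>M ?N) \<longleftrightarrow> (x, y) \<in> ?X \<times> ?Y" for x y
  proof -
    have "merge_coords (x, y) \<in> box l u \<longleftrightarrow>
      (\<forall>r s. r \<le> s \<longrightarrow> x (r, s) \<in> {l $ Coord r s<..<u $ Coord r s}) \<and>
      (\<forall>r s. r < s \<longrightarrow> y (r, s) \<in> {l $ Coord s r<..<u $ Coord s r})"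
      by (auto simp: mem_box_cart merge_coords_def all_coord not_le[symmetric])
    then show ?thesis
      by (simp add: space_pair_measure space_PiM PiE_iff conj_ac)
  qed
  then have eq: "merge_coords -` box l u \<inter> space (?M \<Otimes>\<^sub>M ?N) = ?X \<times> ?Y"
    by (simp only: set_eq_iff split_paired_All) blast
  have "emeasure (distr (?M \<Otimes>\<^sub>M ?N) borel merge_coords) (box l u) = emeasure (?M \<Otimes>\<^sub>M ?N) (?X \<times> ?Y)"
    by (subst emeasure_distr[OF merge_coords_measurable]) (simp_all only: eq borel_open open_box)
  also have "\<dots> = emeasure ?M ?X * emeasure ?N ?Y"
    by (rule N.emeasure_pair_measure_Times; rule sets_PiM_I_finite) auto
  also have "\<dots> = ennreal ((\<Prod>p\<in>{(r, s). r \<le> s}. u $ Coord (fst p) (snd p) - l $ Coord (fst p) (snd p)) *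
      (\<Prod>p\<in>{(r, s). r < s}. u $ Coord (snd p) (fst p) - l $ Coord (snd p) (fst p)))"
    using le by (simp add: product_sigma_finite.emeasure_PiM[OF P] prod_ennreal ennreal_mult prod_nonneg)
  also have "\<dots> = ennreal (\<Prod>p\<in>UNIV. u $ p - l $ p)"
  proof -
    have "(\<Prod>p\<in>UNIV. u $ p - l $ p) = (\<Prod>p\<in>{p. row p \<le> col p} \<union> {p. col p < row p}. u $ p - l $ p)"
      by (rule prod.cong) auto
    also have "\<dots> = (\<Prod>p\<in>{p. row p \<le> col p}. u $ p - l $ p) * (\<Prod>p\<in>{p. col p < row p}. u $ p - l $ p)"
      by (rule prod.union_disjoint) auto
    also have "(\<Prod>p\<in>{p. row p \<le> col p}. u $ p - l $ p) =
        (\<Prod>p\<in>{(r, s). r \<le> s}. u $ Coord (fst p) (snd p) - l $ Coord (fst p) (snd p))"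
      by (rule prod.reindex_bij_witness[where i = "\<lambda>p. Coord (fst p) (snd p)" and j = "\<lambda>p. (row p, col p)"]) auto
    also have "(\<Prod>p\<in>{p. col p < row p}. u $ p - l $ p) =
        (\<Prod>p\<in>{(r, s). r < s}. u $ Coord (snd p) (fst p) - l $ Coord (snd p) (fst p))"
      by (rule prod.reindex_bij_witness[where i = "\<lambda>p. Coord (snd p) (fst p)" and j = "\<lambda>p. (col p, row p)"]) auto
    finally show ?thesis by simp
  qed
  finally show "emeasure (distr (?M \<Otimes>\<^sub>M ?N) borel merge_coords) (box l u) = ennreal (\<Prod>p\<in>UNIV. u $ p - l $ p)" .
qed simp

text \<open>
  In this form linear maps of the Hermitian matrices become linear maps of \<open>real^'k\<close>, whose effect on
  Lebesgue measure is governed by a determinant.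
\<close>

lemma hermitian_measure_eq: "hermitian_measure = distr lborel borel herm"
proof -
  let ?P = "(\<Pi>\<^sub>M p\<in>{(r::'n::{finite,wellorder}, s). r \<le> s}. lborel) \<Otimes>\<^sub>M (\<Pi>\<^sub>M p\<in>{(r::'n, s). r < s}. lborel) :: (('n \<times> 'n \<Rightarrow> real) \<times> ('n \<times> 'n \<Rightarrow> real)) measure"
  have "hermitian_measure = distr ?P borel (herm \<circ> merge_coords)"
    unfolding hermitian_measure_def hermitian_of_coords_eq[abs_def] comp_def ..
  also have "\<dots> = distr (distr ?P borel merge_coords) borel herm"
    by (rule distr_distr[symmetric]) simp_all
  finally show ?thesis by (simp only: lborel_eq_distr_merge_coords[symmetric])
qed

section \<open>The Jacobian of a congruence\<close>

definition real_diag :: "('n \<Rightarrow> real) \<Rightarrow> complex^'n^'n" where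
  "real_diag d = (\<chi> i j. if i = j then of_real (d i) else 0)"

lemma real_diag_mult_left: "(real_diag d ** A) $ i $ j = of_real (d i) * A $ i $ j"
  by (simp add: real_diag_def matrix_matrix_mult_def if_distrib[of "\<lambda>x. x * _"] cong: if_cong)

lemma real_diag_mult_right: "(A ** real_diag d) $ i $ j = A $ i $ j * of_real (d j)"
  by (simp add: real_diag_def matrix_matrix_mult_def if_distrib[of "\<lambda>x. _ * x"] cong: if_cong)

lemma det_real_diag: "det (real_diag d) = of_real (\<Prod>i\<in>UNIV. d i)"
  by (subst det_diagonal) (auto simp: real_diag_def)

lemma ctranspose_real_diag [simp]: "ctranspose (real_diag d) = real_diag d"
  by (auto simp: real_diag_def ctranspose_def vec_eq_iff)

text \<open>
  The elimination matrices have the form \<open>1 + col_mat k w\<close> with \<open>w k = 0\<close>, and then \<open>col_mat k w\<close> squares to zero.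
\<close>

definition col_mat :: "'n \<Rightarrow> ('n \<Rightarrow> complex) \<Rightarrow> complex^'n^'n" where
  "col_mat k w = (\<chi> i j. if j = k then w i else 0)"

lemma col_mat_mult: "(col_mat k w ** A) $ i $ j = w i * A $ k $ j"
  by (simp add: col_mat_def matrix_matrix_mult_def if_distrib[of "\<lambda>x. x * _"] cong: if_cong)

lemma mult_ctranspose_col_mat: "(A ** ctranspose (col_mat k w)) $ i $ j = A $ i $ k * cnj (w j)"
  by (simp add: col_mat_def ctranspose_def matrix_matrix_mult_def if_distrib[of cnj] if_distrib[of "\<lambda>x. _ * x"] cong: if_cong)

text \<open>
  Conjugation by the diagonal matrix turns the unipotent \<open>1 + N\<close> into \<open>1 + 2 N = (1 + N)\<^sup>2\<close>. A
  multiplicative map that is 1 on the diagonal matrix therefore takes a value \<open>z\<close> with \<open>z = z\<^sup>2\<close>, and \<open>z \<noteq> 0\<close>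
  because \<open>1 - N\<close> is the inverse of \<open>1 + N\<close>.
\<close>

lemma character_shear_eq_1:
  fixes \<phi> :: "complex^'n^'n \<Rightarrow> complex"
  assumes mult: "\<And>A B. \<phi> (A ** B) = \<phi> A * \<phi> B"
    and diag: "\<And>d. (\<And>i. 0 < d i) \<Longrightarrow> \<phi> (real_diag d) = 1"
    and d: "\<And>i. 0 < d i" and N: "N ** N = 0" and DN: "real_diag d ** N = 2 *\<^sub>R (N ** real_diag d)"
  shows "\<phi> (mat 1 + N) = 1"
proof -
  have one: "\<phi> (mat 1) = 1"
    using diag[of "\<lambda>_. 1"] by (simp add: real_diag_def mat_def cong: if_cong)
  have "\<phi> (mat 1 + N) * \<phi> (mat 1 - N) = 1"
    by (simp add: one matrix_distribs matrix_sub_ldistrib N flip: mult)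
  then have nz: "\<phi> (mat 1 + N) \<noteq> 0" by auto
  have "real_diag d ** (mat 1 + N) = ((mat 1 + N) ** (mat 1 + N)) ** real_diag d"
    by (simp only: matrix_distribs N DN scaleR_2 matrix_mul_lid matrix_mul_rid add_0_right add.assoc)
  then have "\<phi> (real_diag d ** (mat 1 + N)) = \<phi> ((mat 1 + N) ** (mat 1 + N) ** real_diag d)"
    by (rule arg_cong)
  then have "\<phi> (mat 1 + N) = \<phi> (mat 1 + N) * \<phi> (mat 1 + N)"
    by (simp only: mult diag[OF d] mult_1_left mult_1_right)
  then show ?thesis using nz by simp
qed

text \<open>
  Symmetric Gaussian elimination: \<open>L A L\<^sup>H\<close>, with a unipotent \<open>L\<close>, clears one further row and column of
  \<open>A\<close> outside the diagonal and leaves it positive definite. By the preceding lemma neither \<open>L\<close> nor \<open>L\<^sup>H\<close>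
  changes the value of \<open>\<phi>\<close>, so everything reduces to diagonal matrices with positive entries.
  The induction is on the number of columns that are not yet cleared.
\<close>

lemma character_hpd_eq_1:
  fixes \<phi> :: "complex^'n^'n \<Rightarrow> complex"
  assumes mult: "\<And>A B. \<phi> (A ** B) = \<phi> A * \<phi> B"
    and diag: "\<And>d. (\<And>i. 0 < d i) \<Longrightarrow> \<phi> (real_diag d) = 1"
    and A: "hpd A"
  shows "\<phi> A = 1"
  using A
proof (induction "card {k. \<exists>j. j \<noteq> k \<and> A $ j $ k \<noteq> 0}" arbitrary: A rule: less_induct)
  case (less A)
  have sym: "A $ i $ j = cnj (A $ j $ i)" for i j
    using hpd_hermitian[OF less.prems] by (simp add: ctranspose_def vec_eq_iff)
  have pos: "0 < Re (A $ k $ k)" "A $ k $ k = of_real (Re (A $ k $ k))" for k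
  proof -
    have "(A *v axis k 1) $ k = A $ k $ k"
      by (simp add: matrix_vector_mult_def axis_def if_distrib[of "\<lambda>x. _ * x"] cong: if_cong)
    then have "axis k 1 \<bullet> (A *v axis k 1) = Re (A $ k $ k)"
      by (simp add: inner_axis' inner_complex_def)
    then show "0 < Re (A $ k $ k)"
      using hpd_pos[OF less.prems, of "axis k 1"] by (simp add: axis_eq_0_iff)
    show "A $ k $ k = of_real (Re (A $ k $ k))"
      using sym[of k k] by (simp add: complex_eq_iff)
  qed
  show ?case
  proof (cases "{k. \<exists>j. j \<noteq> k \<and> A $ j $ k \<noteq> 0} = {}")
    case True
    then have "A = real_diag (\<lambda>k. Re (A $ k $ k))"
      using pos(2) by (auto simp: vec_eq_iff real_diag_def)
    then show ?thesis using diag[of "\<lambda>k. Re (A $ k $ k)"] pos(1) by simp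
  next
    case False
    then obtain k where k: "\<exists>j. j \<noteq> k \<and> A $ j $ k \<noteq> 0" by blast
    have nz: "A $ k $ k \<noteq> 0" using pos(1)[of k] by auto
    \<comment> \<open>the multipliers that clear column \<open>k\<close>, with pivot \<open>A $ k $ k > 0\<close>\<close>
    define w where "w i = (if i = k then 0 else - A $ i $ k / A $ k $ k)" for i
    define N where "N = col_mat k w"
    define L where "L = mat 1 + N"
    have NN: "N ** N = 0"
      by (simp add: vec_eq_iff N_def col_mat_mult) (simp add: col_mat_def w_def)
    have NN': "ctranspose N ** ctranspose N = 0"
      unfolding ctranspose_mult[symmetric] NN by (simp add: ctranspose_def vec_eq_iff)
    have "\<phi> L = 1"
      unfolding L_def
    proof (rule character_shear_eq_1[OF mult diag _ NN])
      show "real_diag (\<lambda>i. if i = k then 1 else 2) ** N = 2 *\<^sub>R (N ** real_diag (\<lambda>i. if i = k then 1 else 2))"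
        by (simp add: vec_eq_iff real_diag_mult_left real_diag_mult_right) (simp add: N_def col_mat_def w_def scaleR_conv_of_real)
    qed auto
    moreover have "\<phi> (ctranspose L) = 1"
      unfolding L_def ctranspose_add ctranspose_mat1
    proof (rule character_shear_eq_1[OF mult diag _ NN'])
      show "real_diag (\<lambda>i. if i = k then 2 else 1) ** ctranspose N = 2 *\<^sub>R (ctranspose N ** real_diag (\<lambda>i. if i = k then 2 else 1))"
        by (simp add: vec_eq_iff real_diag_mult_left real_diag_mult_right)
          (simp add: ctranspose_def N_def col_mat_def w_def scaleR_conv_of_real)
    qed auto
    moreover have "\<phi> (L ** A ** ctranspose L) = 1"
    proof (rule less.hyps)
      have "L ** (mat 1 - N) = mat 1"
        by (simp add: L_def matrix_distribs matrix_sub_ldistrib NN)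
      then have "invertible L" by (metis invertible_right_inverse)
      then show hpd': "hpd (L ** A ** ctranspose L)" by (rule hpd_congruence[OF less.prems])
      let ?A' = "L ** A ** ctranspose L"
      have LA: "(L ** A) $ i $ j = A $ i $ j + w i * A $ k $ j" for i j
        by (simp add: L_def matrix_distribs N_def col_mat_mult)
      \<comment> \<open>outside row \<open>k\<close> the column \<open>k\<close> of \<open>L A\<close> vanishes, so the factor \<open>L\<^sup>H\<close> does not change these rows\<close>
      have A': "?A' $ i $ j = A $ i $ j + w i * A $ k $ j" if "i \<noteq> k" for i j
      proof -
        have "?A' $ i $ j = (L ** A) $ i $ j + (L ** A) $ i $ k * cnj (w j)"
          unfolding L_def[of] ctranspose_add ctranspose_mat1 matrix_add_ldistrib
          by (simp add: N_def mult_ctranspose_col_mat)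
        also have "(L ** A) $ i $ k = 0"
          using that nz by (simp add: LA w_def)
        finally show ?thesis by (simp add: LA)
      qed
      have sym': "?A' $ i $ j = cnj (?A' $ j $ i)" for i j
      proof -
        have "ctranspose ?A' $ i $ j = cnj (?A' $ j $ i)" by (simp only: ctranspose_def vec_lambda_beta)
        then show ?thesis by (simp only: hpd_hermitian[OF hpd'])
      qed
      have col_k: "?A' $ i $ k = 0" if "i \<noteq> k" for i
        using A'[OF that, of k] that nz by (simp add: w_def)
      have row_k: "?A' $ k $ i = 0" if "i \<noteq> k" for i
        using col_k[OF that] sym'[of k i] by simp
      have "{l. \<exists>j. j \<noteq> l \<and> ?A' $ j $ l \<noteq> 0} \<subseteq> {l. \<exists>j. j \<noteq> l \<and> A $ j $ l \<noteq> 0} - {k}"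
      proof safe
        fix l j assume lj: "j \<noteq> l" "?A' $ j $ l \<noteq> 0"
        with row_k col_k have "j \<noteq> k" "l \<noteq> k" by auto
        with lj A'[of j l] show "\<exists>j. j \<noteq> l \<and> A $ j $ l \<noteq> 0"
          by (cases "A $ k $ l = 0") auto
      qed (use col_k in auto)
      moreover have "{l. \<exists>j. j \<noteq> l \<and> A $ j $ l \<noteq> 0} - {k} \<subset> {l. \<exists>j. j \<noteq> l \<and> A $ j $ l \<noteq> 0}"
        using k by blast
      ultimately show "card {l. \<exists>j. j \<noteq> l \<and> ?A' $ j $ l \<noteq> 0} < card {l. \<exists>j. j \<noteq> l \<and> A $ j $ l \<noteq> 0}"
        by (intro psubset_card_mono) auto
    qed
    ultimately show ?thesis by (simp add: mult)
  qed
qed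

definition congr_coords ::
  "complex^'n::{finite,wellorder}^'n::{finite,wellorder} \<Rightarrow> real^('n::{finite,wellorder}) coord \<Rightarrow> real^('n::{finite,wellorder}) coord" where
  "congr_coords T v = coords (T ** herm v ** ctranspose T)"

lemma herm_congr_coords: "herm (congr_coords T v) = T ** herm v ** ctranspose T"
  unfolding congr_coords_def by (rule herm_coords) (simp add: ctranspose_mult matrix_mul_assoc)

lemma linear_congr_coords: "linear (congr_coords T)"
  by (rule linearI)
    (simp_all add: congr_coords_def linear_add[OF linear_herm] linear_scale[OF linear_herm]
      linear_add[OF linear_coords] linear_scale[OF linear_coords] matrix_distribs matrix_mult_scaleR)

text \<open>
  Congruence by a product is a composition of congruences, so \<open>congr_det\<close> below is multiplicative.
\<close>

lemma congr_coords_mult: "congr_coords (S ** T) = congr_coords S \<circ> congr_coords T"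
  by (rule ext) (simp add: congr_coords_def[of S] congr_coords_def[of "S ** T"] herm_congr_coords ctranspose_mult matrix_mul_assoc)

lemma congr_coords_real_diag: "congr_coords (real_diag d) v $ p = d (row p) * d (col p) * v $ p"
proof (cases p)
  case (Coord r s)
  show ?thesis
    unfolding Coord
    by (cases r s rule: linorder_cases)
      (auto simp: congr_coords_def coords_def real_diag_mult_left real_diag_mult_right herm_def)
qed

definition congr_det :: "complex^'n::{finite,wellorder}^'n::{finite,wellorder} \<Rightarrow> real" where
  "congr_det T = det (matrix (congr_coords T))"

lemma congr_det_mult: "congr_det (S ** T) = congr_det S * congr_det T"
  by (simp add: congr_det_def congr_coords_mult matrix_compose linear_congr_coords det_mul)

lemma congr_det_real_diag: "congr_det (real_diag d :: complex^'n::{finite,wellorder}^'n::{finite,wellorder}) = (\<Prod>i\<in>UNIV. d i) ^ (2 * CARD('n))"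
proof -
  have "matrix (congr_coords (real_diag d)) $ p $ q = (if p = q then d (row p) * d (col p) else 0)" for p q
    by (simp add: matrix_def congr_coords_real_diag axis_def)
  then have "congr_det (real_diag d :: complex^'n::{finite,wellorder}^'n::{finite,wellorder}) = (\<Prod>p\<in>UNIV. d (row p) * d (col p))"
    unfolding congr_det_def by (subst det_diagonal) auto
  then show ?thesis
    by (simp add: prod_coord prod.distrib power_mult power2_eq_square mult_2 power_add prod_power_distrib)
qed

text \<open>
  The quotient of the two sides is a multiplicative function of \<open>A\<close>, with values in the complex numbers,
  that is 1 on positive diagonal matrices, where the congruence only rescales the coordinates. Hence it is 1
  on all positive definite matrices.
\<close>

lemma congr_det_hpd:
  fixes A :: "complex^'n::{finite,wellorder}^'n::{finite,wellorder}"
  assumes A: "hpd A"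
  shows "congr_det A = Re (det A) ^ (2 * CARD('n))"
proof -
  define \<phi> where "\<phi> T = of_real (congr_det T) / det T ^ (2 * CARD('n))" for T :: "complex^'n::{finite,wellorder}^'n::{finite,wellorder}"
  have "\<phi> A = 1"
  proof (rule character_hpd_eq_1[OF _ _ A])
    show "\<phi> (S ** T) = \<phi> S * \<phi> T" for S T
      by (simp add: \<phi>_def congr_det_mult det_mul power_mult_distrib)
    show "\<phi> (real_diag d) = 1" if "\<And>i. 0 < d i" for d
      using that by (simp add: \<phi>_def congr_det_real_diag det_real_diag) (metis less_irrefl)
  qed
  moreover have "det A \<noteq> 0" using hpd_det(1)[OF A] by auto
  ultimately have "of_real (congr_det A) = det A ^ (2 * CARD('n))"
    by (simp add: \<phi>_def field_simps)
  also have "\<dots> = of_real (Re (det A) ^ (2 * CARD('n)))"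
    using hpd_det(2)[OF A] by (metis of_real_power)
  finally show ?thesis by (simp only: of_real_eq_iff)
qed

text \<open>
  The preimage of a box under \<open>f\<close> is its image under the inverse, whose volume is known.
\<close>

lemma lborel_scale_distr_linear:
  fixes f :: "real^'k::{finite,wellorder} \<Rightarrow> real^'k::{finite,wellorder}"
  assumes f: "linear f" and nz: "det (matrix f) \<noteq> 0"
  shows "lborel = scale_measure (ennreal \<bar>det (matrix f)\<bar>) (distr lborel borel f)"
proof (rule lborel_vec_eqI)
  fix l u :: "real^'k::{finite,wellorder}" assume le: "\<And>i. l $ i \<le> u $ i"
  obtain B where B: "matrix f ** B = mat 1" "B ** matrix f = mat 1"
    using nz unfolding invertible_det_nz[symmetric] invertible_def by blast
  define g where "g = (*v) B"
  have g: "linear g" by (simp add: g_def)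
  have fm: "(*v) (matrix f) = f" by (simp add: f)
  have "matrix f *v (B *v v) = v" "B *v (matrix f *v v) = v" for v
    by (simp_all only: matrix_vector_mul_assoc B matrix_vector_mul_lid)
  then have fg: "f (g v) = v" "g (f v) = v" for v
    by (simp_all only: fm g_def)
  have mg: "matrix g = B" by (simp only: g_def matrix_of_matrix_vector_mul)
  have "det (matrix f ** B) = 1" by (simp only: B det_I)
  then have det: "\<bar>det (matrix f)\<bar> * \<bar>det (matrix g)\<bar> = 1"
    unfolding mg by (simp only: det_mul abs_mult[symmetric] abs_one)
  have meas: "f \<in> borel_measurable borel" by (rule borel_measurable_linear[OF f])
  have vim: "f -` box l u = g ` box l u"
  proof (intro set_eqI iffI)
    fix x assume "x \<in> f -` box l u"
    then show "x \<in> g ` box l u" by (intro image_eqI[of _ _ "f x"]) (auto simp: fg)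
  qed (auto simp: fg)
  have lm: "g ` box l u \<in> lmeasurable" by (intro measurable_linear_image g) simp
  have bor: "g ` box l u \<in> sets borel"
    using measurable_sets[OF meas borel_open[OF open_box[of l u]]] vim by simp
  have "emeasure lborel (f -` box l u) = emeasure lebesgue (g ` box l u)"
    using bor by (simp add: vim)
  also have "\<dots> = ennreal (measure lebesgue (g ` box l u))"
    using lm by (simp add: emeasure_eq_measure2)
  also have "measure lebesgue (g ` box l u) = \<bar>det (matrix g)\<bar> * measure lborel (box l u)"
    by (simp add: measure_linear_image g)
  also have "measure lborel (box l u) = (\<Prod>i\<in>UNIV. u $ i - l $ i)"
    using emeasure_lborel_vec_box[OF le] le by (simp add: measure_def prod_nonneg)
  finally have "emeasure lborel (f -` box l u) = ennreal (\<bar>det (matrix g)\<bar> * (\<Prod>i\<in>UNIV. u $ i - l $ i))" .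
  then have "emeasure (scale_measure (ennreal \<bar>det (matrix f)\<bar>) (distr lborel borel f)) (box l u)
      = ennreal \<bar>det (matrix f)\<bar> * ennreal (\<bar>det (matrix g)\<bar> * (\<Prod>i\<in>UNIV. u $ i - l $ i))"
    using meas by (simp add: emeasure_distr)
  also have "\<dots> = ennreal (\<bar>det (matrix f)\<bar> * \<bar>det (matrix g)\<bar> * (\<Prod>i\<in>UNIV. u $ i - l $ i))"
    by (simp add: ennreal_mult'[symmetric] mult.assoc)
  finally show "emeasure (scale_measure (ennreal \<bar>det (matrix f)\<bar>) (distr lborel borel f)) (box l u) = ennreal (\<Prod>i\<in>UNIV. u $ i - l $ i)"
    by (simp add: det)
qed simp

lemma measurable_matrix_mult [measurable]:
  fixes f g :: "'a \<Rightarrow> complex^'n^'n"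
  assumes "f \<in> borel_measurable M" "g \<in> borel_measurable M"
  shows "(\<lambda>x. f x ** g x) \<in> borel_measurable M"
  by (rule borel_measurable_continuous_Pair[OF assms]) (intro continuous_intros)

lemma scale_measure_distr:
  "f \<in> measurable M N \<Longrightarrow> scale_measure c (distr M N f) = distr (scale_measure c M) N f"
  by (rule measure_eqI) (auto simp: emeasure_distr space_scale_measure cong: measurable_cong_sets)

lemma hermitian_measure_congruence:
  fixes T :: "complex^'n::{finite,wellorder}^'n::{finite,wellorder}"
  assumes T: "hpd T"
  shows "hermitian_measure = scale_measure (ennreal (Re (det T) ^ (2 * CARD('n)))) (distr hermitian_measure borel (\<lambda>X. T ** X ** T))"
proof -
  have [measurable]: "congr_coords T \<in> borel_measurable borel"
    by (rule borel_measurable_linear[OF linear_congr_coords])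
  have pos: "0 < Re (det T)" by (rule hpd_det[OF T])
  have "distr hermitian_measure borel (\<lambda>X. T ** X ** T) = distr lborel borel (\<lambda>v. herm (congr_coords T v))"
    by (simp add: hermitian_measure_eq distr_distr comp_def herm_congr_coords hpd_hermitian[OF T])
  also have "\<dots> = distr (distr lborel borel (congr_coords T)) borel herm"
    by (simp add: distr_distr comp_def)
  finally have "scale_measure (ennreal (congr_det T)) (distr hermitian_measure borel (\<lambda>X. T ** X ** T))
      = distr (scale_measure (ennreal (congr_det T)) (distr lborel borel (congr_coords T))) borel herm"
    by (simp add: scale_measure_distr)
  also have "scale_measure (ennreal (congr_det T)) (distr lborel borel (congr_coords T)) = lborel"
    using lborel_scale_distr_linear[OF linear_congr_coords, of T] pos
    by (simp add: congr_det_hpd[OF T] flip: congr_det_def)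
  finally show ?thesis by (simp add: congr_det_hpd[OF T] flip: hermitian_measure_eq)
qed

section \<open>Complex densities of independent pairs\<close>

lemma has_density_measurable: "has_density M N X f \<Longrightarrow> X \<in> measurable M N"
  by (simp add: has_density_def)

lemma has_density_integrable: "has_density M N X f \<Longrightarrow> integrable N f"
  by (simp add: has_density_def)

lemma has_density_cong_AE:
  assumes X: "has_density M N X f" and eq: "AE x in N. f x = g x" and g: "g \<in> borel_measurable N"
  shows "has_density M N X g"
  unfolding has_density_def
proof (intro conjI ballI)
  have f: "integrable N f" by (rule has_density_integrable[OF X])
  show "X \<in> measurable M N" by (rule has_density_measurable[OF X])
  show "integrable N g"
    using integrable_cong_AE_imp[OF f g] eq by simp
  fix S assume S: "S \<in> sets N"
  have "(LINT x:S|N. f x) = (LINT x:S|N. g x)"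
    unfolding set_lebesgue_integral_def
    using eq f g S by (intro integral_cong_AE) auto
  then show "complex_of_real (measure (distr M N X) S) = (LINT x:S|N. g x)"
    using X S by (simp add: has_density_def)
qed

text \<open>
  The integrals of a complex density over measurable sets are probabilities, so the density agrees almost
  everywhere with a nonnegative real one. This gives access to the theory of real densities
  for complex parameters.
\<close>

lemma has_density_nonneg_real:
  assumes N: "sigma_finite_measure N" and X: "has_density M N X f"
  obtains g :: "'a \<Rightarrow> real" where "g \<in> borel_measurable N" "\<And>x. 0 \<le> g x" "AE x in N. f x = complex_of_real (g x)"
proof -
  interpret sigma_finite_measure N by fact
  have f: "integrable N f" by (rule has_density_integrable[OF X])
  have fS: "(LINT x:S|N. f x) = complex_of_real (measure (distr M N X) S)" if "S \<in> sets N" for S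
    using X that by (simp add: has_density_def)
  have ReS: "(LINT x:S|N. Re (f x)) = measure (distr M N X) S" if S: "S \<in> sets N" for S
  proof -
    have "integrable N (\<lambda>x. indicator S x *\<^sub>R f x)"
      by (rule integrable_mult_indicator[OF S f])
    then have "Re (LINT x|N. indicator S x *\<^sub>R f x) = (LINT x|N. Re (indicator S x *\<^sub>R f x))"
      by (rule integral_Re[symmetric])
    then show ?thesis using fS[OF S] by (simp add: set_lebesgue_integral_def)
  qed
  have "AE x in N. 0 \<le> Re (f x)"
    by (rule density_nonneg) (simp_all add: f ReS integrable_Re)
  moreover have "AE x in N. f x = complex_of_real (Re (f x))"
  proof (rule density_unique_banach)
    show "integrable N (\<lambda>x. complex_of_real (Re (f x)))" using f by (simp add: integrable_Re)
    fix S assume S: "S \<in> sets N"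
    show "(LINT x:S|N. f x) = (LINT x:S|N. complex_of_real (Re (f x)))"
      by (simp add: set_integral_complex_of_real fS ReS S)
  qed (rule f)
  ultimately have "AE x in N. f x = complex_of_real (max 0 (Re (f x)))"
    by eventually_elim simp
  moreover have "(\<lambda>x. max 0 (Re (f x))) \<in> borel_measurable N"
    using f by measurable
  ultimately show ?thesis using that[of "\<lambda>x. max 0 (Re (f x))"] by simp
qed

text \<open>
  Proved for the real versions of the two densities, and carried back to the complex ones almost everywhere.
\<close>

lemma has_density_indep_pair:
  fixes f :: "'a \<Rightarrow> complex" and g :: "'b \<Rightarrow> complex"
  assumes M: "prob_space M" and S: "sigma_finite_measure S" and T: "sigma_finite_measure T"
    and X: "has_density M S X f" and Y: "has_density M T Y g"
    and indep: "distr M S X \<Otimes>\<^sub>M distr M T Y = distr M (S \<Otimes>\<^sub>M T) (\<lambda>\<omega>. (X \<omega>, Y \<omega>))"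
  shows "has_density M (S \<Otimes>\<^sub>M T) (\<lambda>\<omega>. (X \<omega>, Y \<omega>)) (\<lambda>(x, y). f x * g y)"
proof -
  interpret prob_space M by fact
  interpret S: sigma_finite_measure S by fact
  interpret T: sigma_finite_measure T by fact
  interpret ST: pair_sigma_finite S T ..
  obtain f' where f': "f' \<in> borel_measurable S" "\<And>x. 0 \<le> f' x" "AE x in S. f x = complex_of_real (f' x)"
    using has_density_nonneg_real[OF S X] by blast
  obtain g' where g': "g' \<in> borel_measurable T" "\<And>x. 0 \<le> g' x" "AE x in T. g x = complex_of_real (g' x)"
    using has_density_nonneg_real[OF T Y] by blast
  note [measurable] = f'(1) g'(1) borel_measurable_integrable[OF has_density_integrable[OF X]]
    borel_measurable_integrable[OF has_density_integrable[OF Y]]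
  have "has_density M S X (\<lambda>x. complex_of_real (f' x))"
    by (rule has_density_cong_AE[OF X f'(3)]) simp
  then have 1: "distributed M S X (\<lambda>x. ennreal (f' x))"
    by (simp add: has_density_iff_distributed[OF M f'(1,2)])
  have "has_density M T Y (\<lambda>x. complex_of_real (g' x))"
    by (rule has_density_cong_AE[OF Y g'(3)]) simp
  then have 2: "distributed M T Y (\<lambda>x. ennreal (g' x))"
    by (simp add: has_density_iff_distributed[OF M g'(1,2)])
  from distributed_joint_indep'[OF S T 1 2 indep]
  have "distributed M (S \<Otimes>\<^sub>M T) (\<lambda>x. (X x, Y x)) (\<lambda>z. ennreal (f' (fst z) * g' (snd z)))"
    by (simp add: case_prod_unfold ennreal_mult f' g')
  then have "has_density M (S \<Otimes>\<^sub>M T) (\<lambda>x. (X x, Y x)) (\<lambda>z. complex_of_real (f' (fst z) * g' (snd z)))"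
    by (subst has_density_iff_distributed[OF M]) (auto simp: f' g')
  then show ?thesis
  proof (rule has_density_cong_AE)
    have "AE z in S \<Otimes>\<^sub>M T. complex_of_real (f' (fst z)) * complex_of_real (g' (snd z)) = f (fst z) * g (snd z)"
    proof (rule ST.AE_pair_measure)
      show "AE x in S. AE y in T. complex_of_real (f' (fst (x, y))) * complex_of_real (g' (snd (x, y))) = f (fst (x, y)) * g (snd (x, y))"
        using f'(3)
      proof eventually_elim
        fix x assume "f x = complex_of_real (f' x)"
        show "AE y in T. complex_of_real (f' (fst (x, y))) * complex_of_real (g' (snd (x, y))) = f (fst (x, y)) * g (snd (x, y))"
          using g'(3) by eventually_elim (simp add: \<open>f x = _\<close>)
      qed
    qed measurable
    then show "AE z in S \<Otimes>\<^sub>M T. complex_of_real (f' (fst z) * g' (snd z)) = (case z of (x, y) \<Rightarrow> f x * g y)"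
      by (simp add: case_prod_unfold)
  qed measurable
qed

text \<open>
  \<^const>\<open>prob_space.indep_var\<close> relates random variables with values in one common type; this version
  lets the two images have different types, as for \<open>C\<close> and the pair \<open>(A, B)\<close>.
\<close>

lemma indep_var_distr_map:
  assumes M: "prob_space M" and ind: "prob_space.indep_var M S X T Y"
    and f: "f \<in> measurable S S'" and g: "g \<in> measurable T T'"
  shows "distr M S' (\<lambda>\<omega>. f (X \<omega>)) \<Otimes>\<^sub>M distr M T' (\<lambda>\<omega>. g (Y \<omega>)) =
    distr M (S' \<Otimes>\<^sub>M T') (\<lambda>\<omega>. (f (X \<omega>), g (Y \<omega>)))"
proof -
  interpret prob_space M by fact
  have X: "X \<in> measurable M S" and Y: "Y \<in> measurable M T"
    and eq: "distr M S X \<Otimes>\<^sub>M distr M T Y = distr M (S \<Otimes>\<^sub>M T) (\<lambda>x. (X x, Y x))"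
    using ind unfolding indep_var_distribution_eq by auto
  note [measurable] = X Y f g
  have "prob_space (distr M T' (\<lambda>\<omega>. g (Y \<omega>)))" by (rule prob_space_distr) measurable
  then have fin: "sigma_finite_measure (distr (distr M T Y) T' g)"
    by (simp add: distr_distr comp_def prob_space_imp_sigma_finite)
  have "distr M S' (\<lambda>\<omega>. f (X \<omega>)) \<Otimes>\<^sub>M distr M T' (\<lambda>\<omega>. g (Y \<omega>)) =
      distr (distr M S X) S' f \<Otimes>\<^sub>M distr (distr M T Y) T' g"
    by (simp add: distr_distr comp_def)
  also have "\<dots> = distr (distr M S X \<Otimes>\<^sub>M distr M T Y) (S' \<Otimes>\<^sub>M T') (\<lambda>(x, y). (f x, g y))"
    by (rule pair_measure_distr) (simp_all add: fin)
  also have "\<dots> = distr M (S' \<Otimes>\<^sub>M T') (\<lambda>\<omega>. (f (X \<omega>), g (Y \<omega>)))"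
    unfolding eq by (subst distr_distr) (auto simp: comp_def)
  finally show ?thesis .
qed

section \<open>Integration over Hermitian matrices\<close>

lemma sets_hermitian_measure [simp, measurable_cong]: "sets hermitian_measure = sets borel"
  by (simp add: hermitian_measure_eq)

lemma space_hermitian_measure [simp]: "space hermitian_measure = UNIV"
  by (simp add: hermitian_measure_eq)

text \<open>
  Balls in coordinate space have finite volume; a matrix that is not Hermitian is put into such a ball
  according to the coordinates that it happens to have.
\<close>

lemma sigma_finite_hermitian_measure: "sigma_finite_measure hermitian_measure"
proof
  let ?A = "\<lambda>n::nat. coords -` cball 0 (real n) :: (complex^'a::{finite,wellorder}^'a::{finite,wellorder}) set"
  have meas: "?A n \<in> sets borel" for n
    using measurable_sets[OF coords_measurable, of "cball 0 (real n)"] by simp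
  have "(\<Union>n. ?A n) = UNIV"
    using real_arch_simple by (auto simp: mem_cball)
  moreover have "emeasure hermitian_measure (?A n) \<noteq> \<infinity>" for n
  proof -
    have "emeasure hermitian_measure (?A n) = emeasure lborel (herm -` ?A n)"
      using meas by (simp add: hermitian_measure_eq emeasure_distr)
    also have "herm -` ?A n = cball 0 (real n)"
      by auto
    finally show ?thesis using emeasure_lborel_cball_finite[of 0 "real n"] by (simp add: less_top)
  qed
  ultimately show "\<exists>A. countable A \<and> A \<subseteq> sets hermitian_measure \<and> \<Union> A = space hermitian_measure \<and>
      (\<forall>a\<in>A. emeasure (hermitian_measure :: (complex^'a::{finite,wellorder}^'a::{finite,wellorder}) measure) a \<noteq> \<infinity>)"
    using meas by (intro exI[of _ "range ?A"]) auto
qed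

interpretation hermitian: sigma_finite_measure hermitian_measure
  by (rule sigma_finite_hermitian_measure)

interpretation hermitian_pair: pair_sigma_finite hermitian_measure hermitian_measure
  ..

lemma hermitian_measure_density_congruence:
  fixes T :: "complex^'n::{finite,wellorder}^'n::{finite,wellorder}"
  assumes T: "hpd T"
  shows "hermitian_measure = density (distr hermitian_measure borel (\<lambda>X. T ** X ** T)) (\<lambda>_. ennreal (Re (det T) ^ (2 * CARD('n))))"
  (is "_ = density ?D ?c")
proof -
  have "density ?D ?c = scale_measure (ennreal (Re (det T) ^ (2 * CARD('n)))) ?D"
    by (rule measure_eqI) (auto simp: emeasure_density_const)
  then show ?thesis using hermitian_measure_congruence[OF T] by simp
qed

lemma nn_integral_hermitian_congruence:
  fixes T :: "complex^'n::{finite,wellorder}^'n::{finite,wellorder}"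
  assumes T: "hpd T" and f[measurable]: "f \<in> borel_measurable borel"
  shows "(\<integral>\<^sup>+X. f X \<partial>hermitian_measure) =
    ennreal (Re (det T) ^ (2 * CARD('n))) * (\<integral>\<^sup>+X. f (T ** X ** T) \<partial>hermitian_measure)"
  by (subst hermitian_measure_density_congruence[OF T])
    (simp add: nn_integral_density nn_integral_distr nn_integral_cmult)

lemma integral_hermitian_congruence:
  fixes T :: "complex^'n::{finite,wellorder}^'n::{finite,wellorder}" and f :: "_ \<Rightarrow> 'b::{banach,second_countable_topology}"
  assumes T: "hpd T" and f[measurable]: "f \<in> borel_measurable borel"
  shows "(LINT X|hermitian_measure. f X) = Re (det T) ^ (2 * CARD('n)) *\<^sub>R (LINT X|hermitian_measure. f (T ** X ** T))"
proof -
  have "0 \<le> Re (det T) ^ (2 * CARD('n))" by (simp add: power_mult)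
  then show ?thesis
    by (subst hermitian_measure_density_congruence[OF T])
      (simp add: integral_density integral_distr)
qed

lemma borel_measurable_det [measurable]: "(det :: complex^'n^'n \<Rightarrow> complex) \<in> borel_measurable borel"
  by (intro borel_measurable_continuous_onI continuous_intros)

lemma borel_measurable_etr [measurable]: "(etr :: complex^'n^'n \<Rightarrow> complex) \<in> borel_measurable borel"
  unfolding etr_def[abs_def] by (intro borel_measurable_continuous_onI continuous_intros)

text \<open>
  Complex powers of the determinant only involve the real logarithm, which gives both measurability
  and multiplicativity.
\<close>

lemma hpd_det_powr:
  fixes X :: "complex^'n^'n"
  assumes X: "hpd X"
  shows "det X powr s = exp (s * of_real (ln (Re (det X))))"
proof -
  define x where "x = Re (det X)"
  have "0 < x" "det X = of_real x" unfolding x_def by (rule hpd_det[OF X])+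
  then show ?thesis by (simp add: powr_def Ln_of_real)
qed

lemma hpd_det_nz: "hpd X \<Longrightarrow> det X \<noteq> 0"
  using hpd_det(1)[of X] by auto

lemma hpd_det_mult_powr:
  assumes "hpd X" "hpd Y" shows "(det X * det Y) powr s = det X powr s * det Y powr s"
  using hpd_det[OF assms(1)] hpd_det[OF assms(2)]
  by (intro powr_times_real) (auto intro: Reals_of_real simp: complex_is_Real_iff complex_eq_iff)

lemma borel_measurable_det_powr [measurable]:
  "(\<lambda>X. if hpd X then det X powr s else 0) \<in> borel_measurable (borel :: (complex^'n^'n) measure)"
proof -
  have "(\<lambda>X. if hpd X then det X powr s else 0) =
      (\<lambda>X :: complex^'n^'n. if hpd X then exp (s * of_real (ln (Re (det X)))) else 0)"
    by (auto simp: hpd_det_powr)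
  also have "\<dots> \<in> borel_measurable borel" by measurable
  finally show ?thesis .
qed

lemma trace_square_swap: "trace (T ** X ** T) = trace (X ** (T ** T))" for T X :: "complex^'n^'n"
  by (metis matrix_mul_assoc trace_mul_sym)

lemma det_congruence: "T ** T = G \<Longrightarrow> det (T ** X ** T) = det X * det (G :: complex^'n^'n)"
  by (auto simp: det_mul)

text \<open>
  The Jacobian of the congruence by a square root of \<open>G\<close>, in terms of \<open>G\<close>.
\<close>

lemma det_congruence_factor: "hpd T \<Longrightarrow> T ** T = G \<Longrightarrow> Re (det T) ^ (2 * CARD('n)) = Re (det G) ^ CARD('n)"
  for T G :: "complex^'n^'n"
proof -
  assume T: "hpd T" and G: "T ** T = G"
  have "det G = complex_of_real (Re (det T)) * complex_of_real (Re (det T))"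
    using hpd_det(2)[OF T] G by (metis det_mul)
  then have "Re (det G) = Re (det T) ^ 2" by (simp add: power2_eq_square)
  then show ?thesis by (simp add: power_mult)
qed

text \<open>
  The substitution \<open>V = G\<^bsup>1/2\<^esup> C G\<^bsup>1/2\<^esup>\<close> in the integral that defines \<^const>\<open>cmv_Gamma\<close>: it replaces
  \<open>tr V\<close> by \<open>tr (C G)\<close>, \<open>|V|\<close> by \<open>|C| |G|\<close>, and contributes the factor \<open>|G|\<^sup>m\<close>. A linear substitution
  preserves Bochner integrals also in the case of divergence, where both sides are zero.
\<close>

lemma cmv_Gamma_laplace:
  fixes G :: "complex^'n::{finite,wellorder}^'n::{finite,wellorder}"
  assumes G: "hpd G"
  shows "(LINT C:{C. hpd C}|hermitian_measure. etr (- (C ** G)) * det C powr (s - of_nat CARD('n))) =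
    cmv_Gamma TYPE('n) s * det G powr (- s)"
proof -
  define m where "m = CARD('n)"
  define T where "T = hpd_sqrt G"
  have T: "hpd T" "T ** T = G" unfolding T_def by (rule hpd_sqrt[OF G])+
  define f where "f V = etr (- V) * (if hpd V then det V powr (s - of_nat m) else 0)" for V :: "complex^'n::{finite,wellorder}^'n::{finite,wellorder}"
  have f[measurable]: "f \<in> borel_measurable borel" unfolding f_def by measurable
  define J where "J = (LINT C:{C. hpd C}|hermitian_measure. etr (- (C ** G)) * det C powr (s - of_nat m))"
  have fT: "f (T ** X ** T) = det G powr (s - of_nat m) * (indicator {C. hpd C} X *\<^sub>R (etr (- (X ** G)) * det X powr (s - of_nat m)))" for X
  proof (cases "hpd X")
    case True
    have "etr (- (T ** X ** T)) = etr (- (X ** G))"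
      using trace_square_swap[of T X] by (simp add: etr_def trace_def sum_negf T)
    moreover have "hpd (T ** X ** T)"
      using hpd_congruence_iff[of T X] T True by (simp add: hpd_invertible hpd_hermitian)
    ultimately show ?thesis
      using True by (simp add: f_def det_congruence[OF T(2)] hpd_det_mult_powr G)
  next
    case False
    then have "\<not> hpd (T ** X ** T)"
      using hpd_congruence_iff[of T X] T by (simp add: hpd_invertible hpd_hermitian)
    then show ?thesis using False by (simp add: f_def)
  qed
  have "cmv_Gamma TYPE('n) s = (LINT V|hermitian_measure. f V)"
    unfolding cmv_Gamma_def set_lebesgue_integral_def
    by (intro Bochner_Integration.integral_cong) (auto simp: f_def m_def indicator_def)
  also have "\<dots> = Re (det G) ^ m *\<^sub>R (LINT X|hermitian_measure. f (T ** X ** T))"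
    by (simp add: integral_hermitian_congruence[OF T(1) f] det_congruence_factor[OF T] m_def)
  also have "\<dots> = det G ^ m * (det G powr (s - of_nat m) * J)"
    using hpd_det(2)[OF G] unfolding fT J_def set_lebesgue_integral_def
    by (simp add: scaleR_conv_of_real)
  also have "\<dots> = det G powr s * J"
  proof -
    have "det G ^ m * det G powr (s - of_nat m) = det G powr of_nat m * det G powr (s - of_nat m)"
      by (simp only: powr_nat'[OF disjI1[OF hpd_det_nz[OF G]]])
    also have "\<dots> = det G powr s"
      by (simp only: powr_add[symmetric]) simp
    finally have "det G ^ m * det G powr (s - of_nat m) = det G powr s" .
    then show ?thesis by (simp add: mult.assoc[symmetric])
  qed
  finally show ?thesis
    using hpd_det_nz[OF G] by (simp add: J_def m_def powr_minus field_simps)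
qed

section \<open>From the gamma triple to the beta pair\<close>

text \<open>
  The first component is kept, so that the map is invertible where \<open>C\<close> is positive definite.
\<close>

definition whiten ::
  "(complex^'n^'n) \<times> (complex^'n^'n) \<times> (complex^'n^'n) \<Rightarrow> (complex^'n^'n) \<times> (complex^'n^'n) \<times> (complex^'n^'n)" where
  "whiten = (\<lambda>(C, A, B). (C, hpd_inv_sqrt C ** A ** hpd_inv_sqrt C, hpd_inv_sqrt C ** B ** hpd_inv_sqrt C))"

abbreviation herm3 :: "((complex^'n::{finite,wellorder}^'n::{finite,wellorder}) \<times> (complex^'n::{finite,wellorder}^'n::{finite,wellorder}) \<times> (complex^'n::{finite,wellorder}^'n::{finite,wellorder})) measure" where
  "herm3 \<equiv> hermitian_measure \<Otimes>\<^sub>M (hermitian_measure \<Otimes>\<^sub>M hermitian_measure)"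

interpretation herm3: pair_sigma_finite hermitian_measure "hermitian_measure \<Otimes>\<^sub>M hermitian_measure"
  ..

lemma sets_herm2 [measurable_cong]: "sets (hermitian_measure \<Otimes>\<^sub>M hermitian_measure) = sets (borel \<Otimes>\<^sub>M borel)"
  by (intro sets_pair_measure_cong) simp_all

lemma sets_herm3 [measurable_cong]: "sets herm3 = sets (borel \<Otimes>\<^sub>M (borel \<Otimes>\<^sub>M borel))"
  by (intro sets_pair_measure_cong) simp_all

lemma whiten_measurable: "whiten \<in> measurable herm3 herm3"
  unfolding whiten_def by measurable

text \<open>
  The Jacobian of the congruence by \<open>C\<^bsup>-1/2\<^esup>\<close> is the inverse of \<open>|C|\<^sup>m\<close>. The product form spares the
  division.
\<close>

lemma hpd_inv_sqrt_factor:
  fixes C :: "complex^'n^'n"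
  assumes C: "hpd C"
  shows "Re (det C) ^ CARD('n) * Re (det (hpd_inv_sqrt C)) ^ (2 * CARD('n)) = 1"
proof -
  have "det (hpd_sqrt C ** hpd_inv_sqrt C) = 1"
    unfolding hpd_inv_sqrt(2)[OF C] by simp
  then have "complex_of_real (Re (det (hpd_sqrt C)) * Re (det (hpd_inv_sqrt C))) = 1"
    using hpd_det(2)[OF hpd_sqrt(1)[OF C]] hpd_det(2)[OF hpd_inv_sqrt(1)[OF C]]
    by (simp add: det_mul)
  then have "Re (det (hpd_sqrt C)) * Re (det (hpd_inv_sqrt C)) = 1"
    by (simp only: of_real_eq_1_iff)
  then have "(Re (det (hpd_sqrt C)) * Re (det (hpd_inv_sqrt C))) ^ (2 * CARD('n)) = 1" by simp
  then show ?thesis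
    by (simp add: power_mult_distrib det_congruence_factor[OF hpd_sqrt[OF C]])
qed

lemma nn_integral_inv_sqrt_congruence:
  fixes C :: "complex^'n::{finite,wellorder}^'n::{finite,wellorder}"
  assumes C: "hpd C" and f: "f \<in> borel_measurable borel"
  shows "(\<integral>\<^sup>+X. f (hpd_inv_sqrt C ** X ** hpd_inv_sqrt C) \<partial>hermitian_measure) =
    ennreal (Re (det C) ^ CARD('n)) * (\<integral>\<^sup>+X. f X \<partial>hermitian_measure)"
proof -
  have "0 < Re (det C)" by (rule hpd_det[OF C])
  then have "ennreal (Re (det C) ^ CARD('n)) * ennreal (Re (det (hpd_inv_sqrt C)) ^ (2 * CARD('n))) = 1"
    using hpd_inv_sqrt_factor[OF C] by (simp flip: ennreal_mult')
  then show ?thesis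
    by (simp add: nn_integral_hermitian_congruence[OF hpd_inv_sqrt(1)[OF C] f] flip: mult.assoc)
qed

text \<open>
  For fixed \<open>C\<close> each of the two congruences contributes a factor \<open>|C|\<^sup>m\<close>.
\<close>

lemma nn_integral_whiten:
  fixes h :: "(complex^'n::{finite,wellorder}^'n::{finite,wellorder}) \<times> (complex^'n::{finite,wellorder}^'n::{finite,wellorder}) \<times> (complex^'n::{finite,wellorder}^'n::{finite,wellorder}) \<Rightarrow> ennreal"
  assumes h[measurable]: "h \<in> borel_measurable herm3"
  shows "(\<integral>\<^sup>+p. indicator {C. hpd C} (fst p) * h (whiten p) \<partial>herm3) =
    (\<integral>\<^sup>+p. ennreal (indicator {C. hpd C} (fst p) * Re (det (fst p)) ^ (2 * CARD('n))) * h p \<partial>herm3)"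
proof -
  note [measurable] = whiten_measurable
  let ?\<mu> = "hermitian_measure :: (complex^'n::{finite,wellorder}^'n::{finite,wellorder}) measure"
  have inner: "(\<integral>\<^sup>+A. \<integral>\<^sup>+B. indicator {C. hpd C} C * h (whiten (C, A, B)) \<partial>?\<mu> \<partial>?\<mu>) =
      (\<integral>\<^sup>+A. \<integral>\<^sup>+B. ennreal (indicator {C. hpd C} C * Re (det C) ^ (2 * CARD('n))) * h (C, A, B) \<partial>?\<mu> \<partial>?\<mu>)" for C
  proof (cases "hpd C")
    case True
    define r where "r = ennreal (Re (det C) ^ CARD('n))"
    have hC[measurable]: "(\<lambda>q. h (C, q)) \<in> borel_measurable (borel \<Otimes>\<^sub>M borel)"
      using h by measurable
    have step: "(\<integral>\<^sup>+B. h (C, X, hpd_inv_sqrt C ** B ** hpd_inv_sqrt C) \<partial>?\<mu>) = r * (\<integral>\<^sup>+B. h (C, X, B) \<partial>?\<mu>)" for X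
      unfolding r_def by (rule nn_integral_inv_sqrt_congruence[OF True]) measurable
    have "(\<integral>\<^sup>+A. \<integral>\<^sup>+B. h (whiten (C, A, B)) \<partial>?\<mu> \<partial>?\<mu>) =
        (\<integral>\<^sup>+A. r * (\<integral>\<^sup>+B. h (C, hpd_inv_sqrt C ** A ** hpd_inv_sqrt C, B) \<partial>?\<mu>) \<partial>?\<mu>)"
      by (simp add: whiten_def step)
    also have "\<dots> = r * (r * (\<integral>\<^sup>+A. \<integral>\<^sup>+B. h (C, A, B) \<partial>?\<mu> \<partial>?\<mu>))"
      by (simp add: nn_integral_cmult nn_integral_inv_sqrt_congruence[OF True, where f="\<lambda>A. \<integral>\<^sup>+B. h (C, A, B) \<partial>?\<mu>"] r_def)
    also have "\<dots> = ennreal (Re (det C) ^ (2 * CARD('n))) * (\<integral>\<^sup>+A. \<integral>\<^sup>+B. h (C, A, B) \<partial>?\<mu> \<partial>?\<mu>)"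
      using hpd_det(1)[OF True] by (simp add: r_def mult.assoc[symmetric] ennreal_mult'[symmetric] mult_2 power_add)
    finally show ?thesis
      using True by (simp add: nn_integral_cmult)
  qed simp
  have "(\<integral>\<^sup>+p. indicator {C. hpd C} (fst p) * h (whiten p) \<partial>herm3) =
      (\<integral>\<^sup>+C. \<integral>\<^sup>+A. \<integral>\<^sup>+B. indicator {C. hpd C} C * h (whiten (C, A, B)) \<partial>?\<mu> \<partial>?\<mu> \<partial>?\<mu>)"
    by (simp add: hermitian_pair.P.nn_integral_fst[symmetric] hermitian.nn_integral_fst[symmetric])
  also have "\<dots> = (\<integral>\<^sup>+p. ennreal (indicator {C. hpd C} (fst p) * Re (det (fst p)) ^ (2 * CARD('n))) * h p \<partial>herm3)"
    unfolding inner by (simp add: hermitian_pair.P.nn_integral_fst[symmetric] hermitian.nn_integral_fst[symmetric])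
  finally show ?thesis .
qed

text \<open>
  Stated as an equality of measures, the substitution transfers to complex integrals together with the question
  of their integrability.
\<close>

lemma distr_whiten:
  "distr (density herm3 (\<lambda>p. ennreal (indicator {C. hpd C} (fst p)))) herm3 whiten =
    density herm3 (\<lambda>p :: (complex^'n::{finite,wellorder}^'n::{finite,wellorder}) \<times> _ \<times> _. ennreal (indicator {C. hpd C} (fst p) * Re (det (fst p)) ^ (2 * CARD('n))))"
  (is "distr (density ?M ?f) _ _ = density _ ?g")
proof (rule measure_eqI)
  note [measurable] = whiten_measurable
  fix S assume "S \<in> sets (distr (density ?M ?f) herm3 whiten)"
  then have S[measurable]: "S \<in> sets ?M" by simp
  have "emeasure (distr (density ?M ?f) herm3 whiten) S =
      (\<integral>\<^sup>+p. indicator S p \<partial>distr (density ?M ?f) herm3 whiten)"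
    using S by (subst nn_integral_indicator) simp_all
  also have "\<dots> = (\<integral>\<^sup>+p. ?f p * indicator S (whiten p) \<partial>?M)"
    by (subst nn_integral_distr) (simp_all add: nn_integral_density)
  also have "\<dots> = (\<integral>\<^sup>+p. indicator {C. hpd C} (fst p) * indicator S (whiten p) \<partial>?M)"
    by (intro nn_integral_cong) (simp split: split_indicator)
  also have "\<dots> = (\<integral>\<^sup>+p. ?g p * indicator S p \<partial>?M)"
    by (rule nn_integral_whiten) simp
  also have "\<dots> = emeasure (density ?M ?g) S"
    using S by (subst emeasure_density) simp_all
  finally show "emeasure (distr (density ?M ?f) herm3 whiten) S = emeasure (density ?M ?g) S" .
qed simp

lemma integral_whiten:
  fixes h :: "(complex^'n::{finite,wellorder}^'n::{finite,wellorder}) \<times> (complex^'n::{finite,wellorder}^'n::{finite,wellorder}) \<times> (complex^'n::{finite,wellorder}^'n::{finite,wellorder}) \<Rightarrow> complex"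
  assumes h[measurable]: "h \<in> borel_measurable herm3"
  defines "w \<equiv> (\<lambda>p. (indicator {C. hpd C} (fst p) * Re (det (fst p)) ^ (2 * CARD('n)))) :: _ \<Rightarrow> real"
  shows "(LINT p|herm3. indicator {C. hpd C} (fst p) *\<^sub>R h (whiten p)) = (LINT p|herm3. w p *\<^sub>R h p)"
    and "integrable herm3 (\<lambda>p. indicator {C. hpd C} (fst p) *\<^sub>R h (whiten p)) \<longleftrightarrow> integrable herm3 (\<lambda>p. w p *\<^sub>R h p)"
proof -
  note [measurable] = whiten_measurable
  let ?D = "density herm3 (\<lambda>p. ennreal (indicator {C :: complex^'n::{finite,wellorder}^'n::{finite,wellorder}. hpd C} (fst p)))"
  have w0: "0 \<le> w p" for p
    unfolding w_def by (simp add: power_mult)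
  have w[measurable]: "w \<in> borel_measurable herm3"
    unfolding w_def by measurable
  have eq: "distr ?D herm3 whiten = density herm3 (\<lambda>p. ennreal (w p))"
    unfolding w_def by (rule distr_whiten)
  have "(LINT p|herm3. indicator {C. hpd C} (fst p) *\<^sub>R h (whiten p)) = (LINT p|?D. h (whiten p))"
    by (subst integral_density) simp_all
  also have "\<dots> = (LINT p|distr ?D herm3 whiten. h p)"
    by (subst integral_distr) simp_all
  also have "\<dots> = (LINT p|herm3. w p *\<^sub>R h p)"
    unfolding eq using w0 by (subst integral_density) simp_all
  finally show "(LINT p|herm3. indicator {C. hpd C} (fst p) *\<^sub>R h (whiten p)) = (LINT p|herm3. w p *\<^sub>R h p)" .
  have "integrable herm3 (\<lambda>p. indicator {C. hpd C} (fst p) *\<^sub>R h (whiten p)) \<longleftrightarrow> integrable ?D (\<lambda>p. h (whiten p))"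
    by (subst integrable_density) simp_all
  also have "\<dots> \<longleftrightarrow> integrable (distr ?D herm3 whiten) h"
    by (subst integrable_distr_eq) simp_all
  also have "\<dots> \<longleftrightarrow> integrable herm3 (\<lambda>p. w p *\<^sub>R h p)"
    unfolding eq using w0 by (subst integrable_density) simp_all
  finally show "integrable herm3 (\<lambda>p. indicator {C. hpd C} (fst p) *\<^sub>R h (whiten p)) \<longleftrightarrow> integrable herm3 (\<lambda>p. w p *\<^sub>R h p)" .
qed

lemma has_density_gamma_triple:
  fixes A B C :: "'w \<Rightarrow> complex^'n::{finite,wellorder}^'n::{finite,wellorder}"
  assumes M: "prob_space M"
    and A: "has_density M hermitian_measure A f" and B: "has_density M hermitian_measure B g" and C: "has_density M hermitian_measure C h"
    and ind: "prob_space.indep_vars M (\<lambda>_. borel) (\<lambda>i. [A, B, C] ! i) {..<3}"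
  shows "has_density M herm3 (\<lambda>\<omega>. (C \<omega>, A \<omega>, B \<omega>)) (\<lambda>(X, Y, Z). h X * (f Y * g Z))"
proof -
  interpret prob_space M by fact
  let ?X = "\<lambda>i. [A, B, C] ! i"
  let ?P = "\<lambda>J. PiM J (\<lambda>_ :: nat. borel :: (complex^'n::{finite,wellorder}^'n::{finite,wellorder}) measure)"
  have proj: "(\<lambda>u. u i) \<in> measurable (?P J) hermitian_measure" if "i \<in> J" for i J
    using measurable_component_singleton[OF that, of "\<lambda>_. borel"] by (simp cong: measurable_cong_sets)
  have "indep_var (?P {0}) (\<lambda>\<omega>. restrict (\<lambda>i. ?X i \<omega>) {0}) (?P {1}) (\<lambda>\<omega>. restrict (\<lambda>i. ?X i \<omega>) {1})"
    by (rule indep_var_restrict[OF ind]) auto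
  from indep_var_distr_map[OF M this proj[of 0] proj[of 1]]
  have AB: "has_density M (hermitian_measure \<Otimes>\<^sub>M hermitian_measure) (\<lambda>\<omega>. (A \<omega>, B \<omega>)) (\<lambda>(Y, Z). f Y * g Z)"
    by (intro has_density_indep_pair[OF M sigma_finite_hermitian_measure sigma_finite_hermitian_measure A B]) simp
  have "indep_var (?P {2}) (\<lambda>\<omega>. restrict (\<lambda>i. ?X i \<omega>) {2}) (?P {0,1}) (\<lambda>\<omega>. restrict (\<lambda>i. ?X i \<omega>) {0,1})"
    by (rule indep_var_restrict[OF ind]) auto
  from indep_var_distr_map[OF M this proj[of 2] measurable_Pair[OF proj[of 0] proj[of 1]]]
  have "distr M hermitian_measure C \<Otimes>\<^sub>M distr M (hermitian_measure \<Otimes>\<^sub>M hermitian_measure) (\<lambda>\<omega>. (A \<omega>, B \<omega>)) =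
      distr M herm3 (\<lambda>\<omega>. (C \<omega>, A \<omega>, B \<omega>))"
    by simp
  from has_density_indep_pair[OF M sigma_finite_hermitian_measure hermitian_pair.P.sigma_finite_measure_axioms C AB this]
  show ?thesis by (simp add: case_prod_unfold)
qed

lemma powr_mult_of_nat: "z \<noteq> 0 \<Longrightarrow> z ^ n * z powr s = z powr (s + of_nat n)" for z s :: complex
  by (simp only: powr_add powr_nat' simp_thms mult.commute)

section \<open>The density of the beta pair\<close>

lemma hpd_sqrt_conj_inv_sqrt:
  fixes C X :: "complex^'n^'n"
  assumes C: "hpd C"
  shows "hpd_sqrt C ** (hpd_inv_sqrt C ** X ** hpd_inv_sqrt C) ** hpd_sqrt C = X"
proof -
  have "hpd_sqrt C ** (hpd_inv_sqrt C ** X ** hpd_inv_sqrt C) ** hpd_sqrt C =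
      (hpd_sqrt C ** hpd_inv_sqrt C) ** X ** (hpd_inv_sqrt C ** hpd_sqrt C)"
    by (simp only: matrix_mul_assoc)
  then show ?thesis by (simp add: hpd_inv_sqrt[OF C])
qed

text \<open>
  Here \<open>X = C\<^bsup>1/2\<^esup> F C\<^bsup>1/2\<^esup>\<close>, so that \<open>|X| = |C| |F|\<close> and \<open>tr X = tr (C F)\<close>: the square root
  disappears from the density.
\<close>

lemma gamma_density_whiten:
  fixes C X F :: "complex^'n::{finite,wellorder}^'n::{finite,wellorder}"
  assumes C: "hpd C" and F: "F = hpd_inv_sqrt C ** X ** hpd_inv_sqrt C"
  shows "cmv_gamma_density a X = (if hpd F then 1 / cmv_Gamma TYPE('n) a *
    (det C powr (a - of_nat CARD('n)) * det F powr (a - of_nat CARD('n))) * etr (- (C ** F)) else 0)"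
proof -
  note S = hpd_sqrt[OF C]
  have X: "X = hpd_sqrt C ** F ** hpd_sqrt C"
    unfolding F by (rule hpd_sqrt_conj_inv_sqrt[OF C, symmetric])
  have hpd: "hpd X \<longleftrightarrow> hpd F"
    unfolding X by (rule hpd_congruence_iff) (auto simp: hpd_hermitian hpd_invertible S)
  have "trace X = trace (F ** C)"
    unfolding X by (simp add: trace_square_swap S)
  then have "trace X = trace (C ** F)"
    by (simp only: trace_mul_sym[of F C])
  then have "etr (- X) = etr (- (C ** F))"
    by (simp add: etr_def trace_def sum_negf)
  moreover have "det X = det F * det C"
    unfolding X by (rule det_congruence[OF S(2)])
  ultimately show ?thesis
    by (simp add: cmv_gamma_density_def hpd hpd_det_mult_powr C)
qed

lemma etr_add: "etr (A + B) = etr A * etr B"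
  by (simp add: etr_def trace_add exp_add)

text \<open>
  The joint density of \<open>(C, A, B)\<close> written in the variables \<open>(C, F\<^sub>1, F\<^sub>2)\<close>, before multiplication by the
  Jacobian \<open>|C|\<^bsup>2m\<^esup>\<close>. The exponent of \<open>|C|\<close> collects the three exponents \<open>a - m\<close>, \<open>b - m\<close> and \<open>c - m\<close>.
\<close>

definition beta_kernel ::
  "complex \<Rightarrow> complex \<Rightarrow> complex \<Rightarrow> (complex^'n::{finite,wellorder}^'n::{finite,wellorder}) \<times> (complex^'n::{finite,wellorder}^'n::{finite,wellorder}) \<times> (complex^'n::{finite,wellorder}^'n::{finite,wellorder}) \<Rightarrow> complex" where
  "beta_kernel a b c = (\<lambda>(C, F1, F2).
     1 / (cmv_Gamma TYPE('n) a * cmv_Gamma TYPE('n) b * cmv_Gamma TYPE('n) c) *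
     (if hpd F1 then det F1 powr (a - of_nat CARD('n)) else 0) *
     (if hpd F2 then det F2 powr (b - of_nat CARD('n)) else 0) *
     (etr (- (C ** (mat 1 + F1 + F2))) *
      (if hpd C then det C powr (a + b + c - of_nat (3 * CARD('n))) else 0)))"

lemma beta_kernel_measurable [measurable]: "beta_kernel a b c \<in> borel_measurable herm3"
  unfolding beta_kernel_def by measurable

lemma gamma_densities_eq_beta_kernel:
  fixes C A B :: "complex^'n::{finite,wellorder}^'n::{finite,wellorder}"
  shows "cmv_gamma_density c C * (cmv_gamma_density a A * cmv_gamma_density b B) =
    indicator {C. hpd C} C *\<^sub>R beta_kernel a b c (whiten (C, A, B))"
proof (cases "hpd C")
  case True
  define F1 where "F1 = hpd_inv_sqrt C ** A ** hpd_inv_sqrt C"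
  define F2 where "F2 = hpd_inv_sqrt C ** B ** hpd_inv_sqrt C"
  have "etr (- C) * (etr (- (C ** F1)) * etr (- (C ** F2))) = etr (- (C ** (mat 1 + F1 + F2)))"
    by (simp add: matrix_distribs algebra_simps flip: etr_add)
  moreover have "det C powr (c - of_nat CARD('n)) * (det C powr (a - of_nat CARD('n)) * det C powr (b - of_nat CARD('n))) =
      det C powr (a + b + c - of_nat (3 * CARD('n)))"
    by (simp only: powr_add[symmetric]) (simp add: algebra_simps)
  ultimately have *: "etr (- (C ** (mat 1 + F1 + F2))) * det C powr (a + b + c - of_nat (3 * CARD('n))) =
     etr (- C) * (etr (- (C ** F1)) * etr (- (C ** F2))) *
     (det C powr (c - of_nat CARD('n)) * (det C powr (a - of_nat CARD('n)) * det C powr (b - of_nat CARD('n))))"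
    by simp
  show ?thesis
    unfolding gamma_density_whiten[OF True F1_def] gamma_density_whiten[OF True F2_def]
      whiten_def beta_kernel_def prod.case F1_def[symmetric] F2_def[symmetric]
      if_P[OF True] *
    using True by (simp add: cmv_gamma_density_def mult_ac)
qed (simp add: cmv_gamma_density_def)

text \<open>
  The Jacobian raises the exponent of \<open>|C|\<close> to \<open>a + b + c - m\<close>, so that the integral over \<open>C\<close> is the one of
  \<open>cmv_Gamma_laplace\<close> with \<open>G = 1 + F\<^sub>1 + F\<^sub>2\<close>. A vanishing gamma factor makes both sides zero
  by the convention for division by zero.
\<close>

lemma integral_beta_kernel:
  fixes F1 F2 :: "complex^'n::{finite,wellorder}^'n::{finite,wellorder}"
  shows "(LINT C|hermitian_measure. (indicator {C. hpd C} C * Re (det C) ^ (2 * CARD('n))) *\<^sub>R beta_kernel a b c (C, F1, F2)) =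
   (if hpd F1 \<and> hpd F2
       then det F1 powr (a - of_nat CARD('n)) * det F2 powr (b - of_nat CARD('n))
            / (cmv_beta_star TYPE('n) a b c * det (mat 1 + F1 + F2) powr (a + b + c))
       else 0)"
proof (cases "hpd F1 \<and> hpd F2")
  case True
  define s where "s = a + b + c"
  define G where "G = mat 1 + F1 + F2"
  have G: "hpd G" unfolding G_def using True by (intro hpd_add) auto
  define K where "K = 1 / (cmv_Gamma TYPE('n) a * cmv_Gamma TYPE('n) b * cmv_Gamma TYPE('n) c) *
     det F1 powr (a - of_nat CARD('n)) * det F2 powr (b - of_nat CARD('n))"
  have eq: "(indicator {C. hpd C} C * Re (det C) ^ (2 * CARD('n))) *\<^sub>R beta_kernel a b c (C, F1, F2) =
     K * (indicator {C. hpd C} C *\<^sub>R (etr (- (C ** G)) * det C powr (s - of_nat CARD('n))))" for C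
  proof (cases "hpd C")
    case hC: True
    have "complex_of_real (Re (det C) ^ (2 * CARD('n))) * det C powr (s - of_nat (3 * CARD('n))) = det C powr (s - of_nat CARD('n))"
    proof -
      have "complex_of_real (Re (det C) ^ (2 * CARD('n))) = det C ^ (2 * CARD('n))"
        using hpd_det(2)[OF hC] by (metis of_real_power)
      then have "complex_of_real (Re (det C) ^ (2 * CARD('n))) * det C powr (s - of_nat (3 * CARD('n))) =
          det C powr (s - of_nat (3 * CARD('n)) + of_nat (2 * CARD('n)))"
        by (simp only: powr_mult_of_nat[OF hpd_det_nz[OF hC]])
      then show ?thesis by (simp add: algebra_simps)
    qed
    then show ?thesis
      using True hC
      by (simp add: beta_kernel_def K_def scaleR_conv_of_real s_def[symmetric] G_def[symmetric] del: of_real_power)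
  qed simp
  have "(LINT C|hermitian_measure. (indicator {C. hpd C} C * Re (det C) ^ (2 * CARD('n))) *\<^sub>R beta_kernel a b c (C, F1, F2)) =
      K * (LINT C:{C. hpd C}|hermitian_measure. etr (- (C ** G)) * det C powr (s - of_nat CARD('n)))"
    by (simp only: eq set_lebesgue_integral_def integral_mult_right_zero)
  also have "\<dots> = K * (cmv_Gamma TYPE('n) s * det G powr (- s))"
    by (simp only: cmv_Gamma_laplace[OF G])
  finally show ?thesis
    using True by (simp add: K_def cmv_beta_star_def powr_minus divide_inverse mult_ac flip: s_def G_def)
qed (simp add: beta_kernel_def)

theorem theorem4p1:
  fixes M :: "'w measure"
    and a b c :: complex
    and F :: "'w \<Rightarrow> (complex^'n::{finite,wellorder}^'n::{finite,wellorder}) \<times> (complex^'n::{finite,wellorder}^'n::{finite,wellorder})"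
  assumes "prob_space M"
    and "Re a > real CARD('n) - 1"
    and "Re b > real CARD('n) - 1"
    and "Re c > real CARD('n) - 1"
    and "cbimatrix_beta_II M a b c F"
  shows "has_density M (hermitian_measure \<Otimes>\<^sub>M hermitian_measure) F
    (\<lambda>(F1, F2).
       if hpd F1 \<and> hpd F2
       then det F1 powr (a - of_nat CARD('n)) * det F2 powr (b - of_nat CARD('n))
            / (cmv_beta_star TYPE('n) a b c * det (mat 1 + F1 + F2) powr (a + b + c))
       else 0)"
proof -
  interpret prob_space M by fact
  let ?\<mu>2 = "hermitian_measure \<Otimes>\<^sub>M hermitian_measure :: ((complex^'n::{finite,wellorder}^'n::{finite,wellorder}) \<times> (complex^'n::{finite,wellorder}^'n::{finite,wellorder})) measure"
  obtain A B C where
    A: "has_density M hermitian_measure A (cmv_gamma_density a)" and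
    B: "has_density M hermitian_measure B (cmv_gamma_density b)" and
    C: "has_density M hermitian_measure C (cmv_gamma_density c)" and
    ind: "indep_vars (\<lambda>_. borel) (\<lambda>i. [A, B, C] ! i) {..<3}" and
    F: "\<And>\<omega>. \<omega> \<in> space M \<Longrightarrow> F \<omega> = snd (whiten (C \<omega>, A \<omega>, B \<omega>))"
    using assms(5) by (auto simp: cbimatrix_beta_II_def cmv_gamma_distributed_def whiten_def)
  define Z where "Z \<omega> = (C \<omega>, A \<omega>, B \<omega>)" for \<omega>
  define k where "k = (\<lambda>(X :: complex^'n::{finite,wellorder}^'n::{finite,wellorder}, Y). (indicator {C. hpd C} X * Re (det X) ^ (2 * CARD('n))) *\<^sub>R beta_kernel a b c (X, Y))"
  \<comment> \<open>the marginal density of the pair, with \<open>C\<close> integrated out of the joint density \<open>k\<close>\<close>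
  define d where "d Y = (LINT X|hermitian_measure. k (X, Y))" for Y
  note [measurable] = whiten_measurable
  have Z: "has_density M herm3 Z (\<lambda>p. indicator {C. hpd C} (fst p) *\<^sub>R beta_kernel a b c (whiten p))"
  proof -
    have "has_density M herm3 Z (\<lambda>(X, Y, Z). cmv_gamma_density c X * (cmv_gamma_density a Y * cmv_gamma_density b Z))"
      unfolding Z_def by (rule has_density_gamma_triple[OF assms(1) A B C ind])
    also have "(\<lambda>(X, Y, Z). cmv_gamma_density c X * (cmv_gamma_density a Y * cmv_gamma_density b Z)) =
       (\<lambda>p. indicator {C. hpd C} (fst p) *\<^sub>R beta_kernel a b c (whiten p))"
      by (simp add: fun_eq_iff gamma_densities_eq_beta_kernel)
    finally show ?thesis .
  qed
  then have Zm[measurable]: "Z \<in> measurable M herm3" by (rule has_density_measurable)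
  have k: "integrable herm3 k"
    using integral_whiten(2)[OF beta_kernel_measurable[where 'a = 'n and a = a and b = b and c = c]] has_density_integrable[OF Z]
    by (simp add: k_def case_prod_unfold)
  have "has_density M ?\<mu>2 F d"
    unfolding has_density_def
  proof (intro conjI ballI)
    have "(\<lambda>\<omega>. snd (whiten (Z \<omega>))) \<in> measurable M ?\<mu>2" by measurable
    then show Fm: "F \<in> measurable M ?\<mu>2"
      by (subst measurable_cong[of M F "\<lambda>\<omega>. snd (whiten (Z \<omega>))"]) (simp_all add: F Z_def)
    show "integrable ?\<mu>2 d"
      unfolding d_def by (rule herm3.integrable_snd) (simp add: k)
    fix S assume S[measurable]: "S \<in> sets ?\<mu>2"
    let ?S = "{p \<in> space herm3. snd (whiten p) \<in> S}"
    have S'[measurable]: "?S \<in> sets herm3" by measurable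
    have "measure (distr M ?\<mu>2 F) S = measure (distr M herm3 Z) ?S"
    proof -
      have "F -` S \<inter> space M = Z -` ?S \<inter> space M"
        by (auto simp: F Z_def space_pair_measure)
      then show ?thesis
        by (simp only: measure_distr[OF Fm S] measure_distr[OF Zm S'])
    qed
    then have "complex_of_real (measure (distr M ?\<mu>2 F) S) =
        (LINT p:?S|herm3. indicator {C. hpd C} (fst p) *\<^sub>R beta_kernel a b c (whiten p))"
      using Z S' by (simp add: has_density_def)
    also have "\<dots> = (LINT p|herm3. indicator {C. hpd C} (fst p) *\<^sub>R (indicator S (snd (whiten p)) *\<^sub>R beta_kernel a b c (whiten p)))"
      unfolding set_lebesgue_integral_def
      by (intro Bochner_Integration.integral_cong) (auto simp: indicator_def)
    also have "\<dots> = (LINT p|herm3. indicator S (snd p) *\<^sub>R k p)"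
      by (subst integral_whiten(1)[of "\<lambda>p. indicator S (snd p) *\<^sub>R beta_kernel a b c p"])
        (simp_all add: k_def case_prod_unfold mult_ac)
    also have "\<dots> = (LINT Y|?\<mu>2. LINT X|hermitian_measure. indicator S Y *\<^sub>R k (X, Y))"
    proof -
      have "integrable herm3 (\<lambda>p. indicator {p \<in> space herm3. snd p \<in> S} p *\<^sub>R k p)"
        by (intro integrable_mult_indicator k) measurable
      then have "integrable herm3 (\<lambda>p. indicator S (snd p) *\<^sub>R k p)"
        by (rule Bochner_Integration.integrable_cong[THEN iffD1, rotated 2]) (auto simp: indicator_def)
      then show ?thesis
        by (subst herm3.integral_snd) (simp_all add: case_prod_unfold)
    qed
    also have "\<dots> = (LINT Y:S|?\<mu>2. d Y)"
      by (simp add: set_lebesgue_integral_def d_def)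
    finally show "complex_of_real (measure (distr M ?\<mu>2 F) S) = (LINT Y:S|?\<mu>2. d Y)" .
  qed
  also have "d = (\<lambda>(F1, F2).
       if hpd F1 \<and> hpd F2
       then det F1 powr (a - of_nat CARD('n)) * det F2 powr (b - of_nat CARD('n))
            / (cmv_beta_star TYPE('n) a b c * det (mat 1 + F1 + F2) powr (a + b + c))
       else 0)"
    unfolding d_def k_def by (auto simp: fun_eq_iff integral_beta_kernel simp del: scaleR_conv_of_real)
  finally show ?thesis .
qed

end
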